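(* Suppose that $(M^n,g)$ is a complete Riemannian manifold and $\mu$ is a finite nonnegative Radon measure on a bounded domain $G\subset M^n$. Let $\alpha\in(1,n)$ and let $d<n-\alpha$. Let $S$ be a compact subset of $G$ whose Hausdorff dimension is greater than $d$. Then there are a point $p\in S$, a subset $E$ that is $\alpha$-thin at $p$, a constant $C$ and a small $\delta>0$ such that $$\int_{G}\frac{1}{d(x,y)^{n-\alpha}}\,d\mu(y)\le\frac{C}{d(x,p)^{n-\alpha-d}}$$ for all $x\in B_\delta(p)\setminus E$.
   Context: $d(\cdot,\cdot)$ is the Riemannian distance of $(M^n,g)$ and $B_r(p)$ the open geodesic ball. (The number $d$ is unrelated to the distance function $d(\cdot,\cdot)$.) At $x=p$ the right-hand side is read as $+\infty$. The Hausdorff dimension of the empty set is taken to be $-\infty$. Capacity. For a bounded open subset $U\subseteq M^n$, $\alpha\in(1,n)$, and a nonnegative Radon measure $\nu$ on $U$, put $\mathscr R^{\alpha,U}_\nu(x)=\int_U d(x,y)^{-(n-\alpha)}\,d\nu(y)$ for $x\in U$. For $E\subseteq U$ define $$\mathscr C^\alpha(E,U)=\inf\{\nu(U):\ \nu\ge 0 \text{ a Radon measure on } U,\ \mathscr R^{\alpha,U}_\nu(x)\ge 1\text{ for all }x\in E\}.$$ Thinness. For $p\in M^n$, small $\delta>0$ and $i\ge 1$ let $\omega_i^\delta(p)=\{x: d(x,p)\in[2^{-i}\delta,2^{-i+1}\delta]\}$ and $\Omega_i^\delta(p)=\{x: d(x,p)\in(2^{-i-1}\delta,2^{-i+2}\delta)\}$.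 For $\alpha\in(1,n)$, a set $E$ is $\alpha$-thin at $p$ if, for some small $\delta>0$, $$\sum_{i\ge1}\frac{\mathscr C^\alpha(E\cap\omega_i^\delta(p),\Omega_i^\delta(p))}{\mathscr C^\alpha(\partial B_{2^{-i}\delta}(p),B_{2^{-i+1}\delta}(p))}<\infty.$$ *)

theory Defs
  imports "HOL-Analysis.Analysis"
begin

section \<open>Riemannian manifolds\<close>

text \<open>
  The manifold is a whole type \<open>'a\<close>; charts take values in \<open>real ^ 'n\<close>, so its dimension is
  \<open>CARD('n)\<close>. A Riemannian metric is given by its coordinate expressions: \<open>g c x v w\<close> is the inner
  product at the point \<open>x\<close> of the two tangent vectors whose components in the chart \<open>c\<close> are
  \<open>v\<close> and \<open>w\<close>.
\<close>

type_synonym ('a, 'n) chart = "'a set \<times> ('a \<Rightarrow> real ^ 'n)"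

type_synonym ('a, 'n) metric_tensor = "('a, 'n) chart \<Rightarrow> 'a \<Rightarrow> real ^ 'n \<Rightarrow> real ^ 'n \<Rightarrow> real"

text \<open>The following two notions are meant for open domains \<open>X\<close>.\<close>

primrec Ck_on :: "nat \<Rightarrow> 'b::real_normed_vector set \<Rightarrow> ('b \<Rightarrow> 'c::real_normed_vector) \<Rightarrow> bool" where
  "Ck_on 0 X f \<longleftrightarrow> continuous_on X f"
| "Ck_on (Suc k) X f \<longleftrightarrow>
     (\<forall>x\<in>X. f differentiable (at x)) \<and>
     (\<forall>v. Ck_on k X (\<lambda>x. frechet_derivative f (at x) v))"

definition smooth_on :: "'b::real_normed_vector set \<Rightarrow> ('b \<Rightarrow> 'c::real_normed_vector) \<Rightarrow> bool" where
  "smooth_on X f \<longleftrightarrow> (\<forall>k. Ck_on k X f)"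

definition chart_inv :: "('a, 'n) chart \<Rightarrow> real ^ 'n \<Rightarrow> 'a" where
  "chart_inv c = inv_into (fst c) (snd c)"

definition smooth_atlas :: "('a::topological_space, 'n::finite) chart set \<Rightarrow> bool" where
  "smooth_atlas A \<longleftrightarrow>
     (\<Union>c\<in>A. fst c) = UNIV \<and>
     (\<forall>c\<in>A. open (fst c) \<and> open (snd c ` fst c) \<and>
            homeomorphism (fst c) (snd c ` fst c) (snd c) (chart_inv c)) \<and>
     (\<forall>c\<in>A. \<forall>c'\<in>A. smooth_on (snd c ` (fst c \<inter> fst c')) (snd c' \<circ> chart_inv c))"

definition smooth_metric_tensor ::
  "('a::topological_space, 'n::finite) chart set \<Rightarrow> ('a, 'n) metric_tensor \<Rightarrow> bool" where
  "smooth_metric_tensor A g \<longleftrightarrow>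
     (\<forall>c\<in>A. \<forall>x\<in>fst c. bilinear (g c x) \<and>
        (\<forall>v w. g c x v w = g c x w v) \<and> (\<forall>v. v \<noteq> 0 \<longrightarrow> 0 < g c x v v)) \<and>
     (\<forall>c\<in>A. \<forall>v w. smooth_on (snd c ` fst c) (\<lambda>u. g c (chart_inv c u) v w)) \<and>
     (\<forall>c\<in>A. \<forall>c'\<in>A. \<forall>x\<in>fst c \<inter> fst c'.
        let D = frechet_derivative (snd c' \<circ> chart_inv c) (at (snd c x))
        in \<forall>v w. g c x v w = g c' x (D v) (D w))"

text \<open>
  As usual, Riemannian manifolds are connected, so that the distance between any two points is
  finite.
\<close>

definition riemannian_manifold ::
  "('a::{t2_space, second_countable_topology}, 'n::finite) chart set
    \<Rightarrow> ('a, 'n) metric_tensor \<Rightarrow> bool" where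
  "riemannian_manifold A g \<longleftrightarrow>
     connected (UNIV :: 'a set) \<and> smooth_atlas A \<and> smooth_metric_tensor A g"

text \<open>Differentiability on \<open>{a..b}\<close> is one-sided at the end points.\<close>

definition C1_curve_on ::
  "('a::topological_space, 'n::finite) chart set \<Rightarrow> real \<Rightarrow> real \<Rightarrow> (real \<Rightarrow> 'a) \<Rightarrow> bool" where
  "C1_curve_on A a b \<gamma> \<longleftrightarrow>
     continuous_on {a..b} \<gamma> \<and>
     (\<forall>c\<in>A. \<exists>D. continuous_on {t\<in>{a..b}. \<gamma> t \<in> fst c} D \<and>
        (\<forall>t\<in>{a..b}. \<gamma> t \<in> fst c \<longrightarrow>
           ((snd c \<circ> \<gamma>) has_vector_derivative D t) (at t within {a..b})))"

definition piecewise_C1_curve ::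
  "('a::topological_space, 'n::finite) chart set \<Rightarrow> (real \<Rightarrow> 'a) \<Rightarrow> bool" where
  "piecewise_C1_curve A \<gamma> \<longleftrightarrow>
     (\<exists>F. finite F \<and> {0, 1} \<subseteq> F \<and> F \<subseteq> {0..1} \<and>
        (\<forall>a\<in>F. \<forall>b\<in>F. a < b \<and> {a<..<b} \<inter> F = {} \<longrightarrow> C1_curve_on A a b \<gamma>))"

text \<open>
  The speed does not depend on the choice of the chart around \<open>\<gamma> t\<close>. At the finitely many break
  points of a piecewise \<open>C\<^sup>1\<close> curve its value is arbitrary, which does not affect the length.
\<close>

definition curve_speed ::
  "('a, 'n::finite) chart set \<Rightarrow> ('a, 'n) metric_tensor \<Rightarrow> (real \<Rightarrow> 'a) \<Rightarrow> real \<Rightarrow> real" where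
  "curve_speed A g \<gamma> t =
     (let c = (SOME c. c \<in> A \<and> \<gamma> t \<in> fst c);
          v = vector_derivative (snd c \<circ> \<gamma>) (at t)
      in sqrt (g c (\<gamma> t) v v))"

definition curve_length ::
  "('a, 'n::finite) chart set \<Rightarrow> ('a, 'n) metric_tensor \<Rightarrow> (real \<Rightarrow> 'a) \<Rightarrow> real" where
  "curve_length A g \<gamma> = integral {0..1} (curve_speed A g \<gamma>)"

definition riemannian_dist ::
  "('a::topological_space, 'n::finite) chart set \<Rightarrow> ('a, 'n) metric_tensor \<Rightarrow> 'a \<Rightarrow> 'a \<Rightarrow> real" where
  "riemannian_dist A g x y =
     Inf {curve_length A g \<gamma> |\<gamma>. piecewise_C1_curve A \<gamma> \<and> \<gamma> 0 = x \<and> \<gamma> 1 = y}"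

text \<open>
  Balls, bounded sets, Hausdorff dimension and completeness refer to the Riemannian distance, so we
  let that distance be the \<open>dist\<close> of the type. This loses no generality: the Riemannian distance of
  a connected manifold is a metric inducing the manifold topology. Completeness is that of the
  metric space; by Hopf-Rinow this is the same as geodesic completeness.
\<close>

definition complete_riemannian_manifold ::
  "('a::{metric_space, second_countable_topology}, 'n::finite) chart set
    \<Rightarrow> ('a, 'n) metric_tensor \<Rightarrow> bool" where
  "complete_riemannian_manifold A g \<longleftrightarrow>
     riemannian_manifold A g \<and>
     (\<forall>x y. dist x y = riemannian_dist A g x y) \<and>
     complete (UNIV :: 'a set)"


section \<open>Hausdorff dimension\<close>

text \<open>
  \<open>diam(X)\<^sup>s\<close> with the conventions \<open>diam({})\<^sup>s = 0\<close> and \<open>0\<^sup>0 = 1\<close> for nonempty sets; note that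
  \<open>0 powr 0 = 0\<close> in the library.
\<close>

definition diam_pow :: "real \<Rightarrow> 'a::metric_space set \<Rightarrow> ennreal" where
  "diam_pow s X =
     (if X = {} then 0 else if s = 0 then 1 else ennreal (diameter X powr s))"

text \<open>Boundedness is required because the library's \<open>diameter\<close> is junk for unbounded sets.\<close>

definition hausdorff_premeasure :: "real \<Rightarrow> real \<Rightarrow> 'a::metric_space set \<Rightarrow> ennreal" where
  "hausdorff_premeasure s \<epsilon> X =
     Inf {(\<Sum>i. diam_pow s (V i)) |V :: nat \<Rightarrow> 'a set.
            X \<subseteq> (\<Union>i. V i) \<and> (\<forall>i. bounded (V i) \<and> diameter (V i) \<le> \<epsilon>)}"

definition hausdorff_measure :: "real \<Rightarrow> 'a::metric_space set \<Rightarrow> ennreal" where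
  "hausdorff_measure s X = (SUP \<epsilon>\<in>{0<..}. hausdorff_premeasure s \<epsilon> X)"

definition hausdorff_dim :: "'a::metric_space set \<Rightarrow> ereal" where
  "hausdorff_dim X =
     (if X = {} then -\<infinity> else Inf {ereal s |s. 0 \<le> s \<and> hausdorff_measure s X = 0})"


section \<open>Radon measures, Riesz potentials, capacity and thinness\<close>

text \<open>A Radon measure on \<open>U\<close> lives on the Borel \<open>\<sigma>\<close>-algebra of the subspace \<open>U\<close>; its space is \<open>U\<close>.\<close>

definition radon_measure_on :: "'a::topological_space set \<Rightarrow> 'a measure \<Rightarrow> bool" where
  "radon_measure_on U \<nu> \<longleftrightarrow>
     sets \<nu> = sets (restrict_space borel U) \<and>
     (\<forall>K. compact K \<and> K \<subseteq> U \<longrightarrow> emeasure \<nu> K < \<infinity>) \<and>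
     (\<forall>B\<in>sets \<nu>. emeasure \<nu> B = (SUP K\<in>{K. compact K \<and> K \<subseteq> B}. emeasure \<nu> K))"

text \<open>\<open>d(x,y)\<^sup>-\<^sup>s\<close> for \<open>s > 0\<close>, with the value \<open>\<infinity>\<close> on the diagonal.\<close>

definition riesz_kernel :: "real \<Rightarrow> 'a::metric_space \<Rightarrow> 'a \<Rightarrow> ennreal" where
  "riesz_kernel s x y = (if x = y then \<infinity> else ennreal (1 / dist x y powr s))"

text \<open>
  For \<open>\<nu>\<close> a measure on \<open>U\<close>, the integral extends over \<open>space \<nu> = U\<close>. The parameter \<open>n\<close>
  is the dimension of the manifold.
\<close>

definition riesz_potential :: "nat \<Rightarrow> real \<Rightarrow> 'a::metric_space measure \<Rightarrow> 'a \<Rightarrow> ennreal" where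
  "riesz_potential n \<alpha> \<nu> x = (\<integral>\<^sup>+ y. riesz_kernel (real n - \<alpha>) x y \<partial>\<nu>)"

definition capacity :: "nat \<Rightarrow> real \<Rightarrow> 'a::metric_space set \<Rightarrow> 'a set \<Rightarrow> ennreal" where
  "capacity n \<alpha> E U =
     Inf {emeasure \<nu> U |\<nu>. radon_measure_on U \<nu> \<and> (\<forall>x\<in>E. 1 \<le> riesz_potential n \<alpha> \<nu> x)}"

definition closed_annulus :: "real \<Rightarrow> 'a::metric_space \<Rightarrow> nat \<Rightarrow> 'a set" where
  "closed_annulus \<delta> p i = {x. dist x p \<in> {\<delta> / 2 ^ i .. 2 * \<delta> / 2 ^ i}}"

definition open_annulus :: "real \<Rightarrow> 'a::metric_space \<Rightarrow> nat \<Rightarrow> 'a set" where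
  "open_annulus \<delta> p i = {x. dist x p \<in> {\<delta> / 2 ^ (i + 1) <..< 4 * \<delta> / 2 ^ i}}"

text \<open>
  Replacing \<open>\<delta>\<close> by \<open>\<delta> / 2 ^ k\<close> only drops the first \<open>k\<close> terms of the series, so ``some \<open>\<delta> > 0\<close>''
  and ``some arbitrarily small \<open>\<delta> > 0\<close>'' mean the same. The series starts at \<open>i = 1\<close>, hence
  the \<open>Suc\<close>.
\<close>

definition thin_term :: "nat \<Rightarrow> real \<Rightarrow> 'a::metric_space set \<Rightarrow> 'a \<Rightarrow> real \<Rightarrow> nat \<Rightarrow> ennreal" where
  "thin_term n \<alpha> E p \<delta> i =
     capacity n \<alpha> (E \<inter> closed_annulus \<delta> p i) (open_annulus \<delta> p i) /
     capacity n \<alpha> (frontier (ball p (\<delta> / 2 ^ i))) (ball p (2 * \<delta> / 2 ^ i))"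

definition thin_at :: "nat \<Rightarrow> real \<Rightarrow> 'a::metric_space set \<Rightarrow> 'a \<Rightarrow> bool" where
  "thin_at n \<alpha> E p \<longleftrightarrow> (\<exists>\<delta>>0. (\<Sum>i. thin_term n \<alpha> E p \<delta> (Suc i)) < \<infinity>)"

end

theory Submission
  imports Defs
begin

text \<open>
Put \<open>s = n - \<alpha>\<close>, so that \<open>0 < s < n - 1\<close>, and choose \<open>m\<close> with \<open>d < m < s\<close>, \<open>0 \<le> m\<close> and
\<open>hausdorff_measure m S \<noteq> 0\<close>. The proof compares three estimates at dyadic scales around a well chosen
point \<open>p\<close>.

Choice of the point. If at every \<open>p \<in> S\<close> the ratio \<open>\<mu>(B\<^sub>t(p)) / t\<^sup>m\<close> were unbounded in \<open>t\<close>, then balls with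
a huge ratio would cover \<open>S\<close>, and a Vitali selection among them would make the \<open>m\<close>-dimensional
Hausdorff measure of \<open>S\<close> zero. So some \<open>p \<in> S\<close> has \<open>\<mu>(B\<^sub>t(p)) \<le> C t\<^sup>m\<close> for all \<open>t > 0\<close>
(\<open>exists_point_of_bounded_density\<close>).

Splitting the potential. Let \<open>x\<close> lie in the annulus \<open>\<omega>\<^sub>i\<close> of inner radius \<open>r\<^sub>i = \<delta> / 2\<^sup>i\<close>. Mass outside the
larger annulus \<open>\<Omega>\<^sub>i\<close> is at a distance from \<open>x\<close> comparable to \<open>r\<^sub>i + d(y,p)\<close>; summing over dyadic shells
it contributes \<open>O(r\<^sub>i\<^sup>m\<^sup>-\<^sup>s)\<close>, because \<open>m < s\<close> (\<open>far_potential_le\<close>). This is at most the admissible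
\<open>O(r\<^sub>i\<^sup>d\<^sup>-\<^sup>s)\<close>. The contribution of \<open>\<Omega>\<^sub>i\<close> exceeds \<open>r\<^sub>i\<^sup>d\<^sup>-\<^sup>s\<close> only on a set \<open>E\<^sub>i\<close>, and these sets make up
\<open>E\<close>. Testing the capacity of \<open>E\<^sub>i\<close> with the restriction of \<open>\<mu>\<close> to \<open>\<Omega>\<^sub>i\<close> divided by \<open>r\<^sub>i\<^sup>d\<^sup>-\<^sup>s\<close> gives
\<open>\<C>(E\<^sub>i, \<Omega>\<^sub>i) \<le> \<mu>(\<Omega>\<^sub>i) / r\<^sub>i\<^sup>d\<^sup>-\<^sup>s = O(r\<^sub>i\<^sup>s r\<^sub>i\<^sup>m\<^sup>-\<^sup>d)\<close> (\<open>capacity_le_of_near_potential\<close>).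

The denominators. The capacity of a geodesic sphere of small radius \<open>r\<close> in the ball of radius
\<open>2r\<close> is at least \<open>c r\<^sup>s\<close> (\<open>capacity_frontier_ball_ge\<close>). By Fubini it is enough to put on the sphere a measure whose
potential is \<open>O(r\<^sup>-\<^sup>s)\<close> times its mass. In a bi-Lipschitz chart at \<open>p\<close> (\<open>bilipschitz_chart\<close>), send each
point \<open>u\<close> of the Euclidean unit ball to the first point where the ray through \<open>u\<close> leaves the geodesic
ball, and push Lebesgue measure forward. A ball of radius \<open>t\<close> pulls back to a part of a tube of width
\<open>O(t/r)\<close>, of volume \<open>O((t/r)\<^sup>n\<^sup>-\<^sup>1)\<close>, and \<open>n - 1 > s\<close> makes the dyadic sum for the potential converge.
This is where \<open>\<alpha> > 1\<close> enters.

The ratios of capacities are therefore \<open>O(r\<^sub>i\<^sup>m\<^sup>-\<^sup>d)\<close>, a geometric series, so \<open>E\<close> is thin at \<open>p\<close>. The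
room between \<open>d\<close> and \<open>m\<close> is what makes the series converge.
\<close>


section \<open>Hausdorff measure and points of bounded density\<close>

text \<open>
Vitali selection for finitely many balls: a ball of largest radius swallows, when tripled, every ball
that it meets; keep it, discard those, and recurse.
\<close>

lemma finite_ball_selection:
  fixes x :: "'i \<Rightarrow> 'a::metric_space" and r :: "'i \<Rightarrow> real"
  assumes "finite I" and "\<And>i. i \<in> I \<Longrightarrow> 0 < r i"
  shows "\<exists>J\<subseteq>I. disjoint_family_on (\<lambda>i. ball (x i) (r i)) J \<and>
    (\<forall>i\<in>I. \<exists>j\<in>J. ball (x i) (r i) \<subseteq> ball (x j) (3 * r j))"
  using assms
proof (induction I rule: finite_psubset_induct)
  case (psubset I)
  show ?case
  proof (cases "I = {}")
    case False
    have "Max (r ` I) \<in> r ` I" using psubset.hyps(1) False by (intro Max_in) auto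
    then obtain k where k: "k \<in> I" "r k = Max (r ` I)" by auto
    have max: "r i \<le> r k" if "i \<in> I" for i
      unfolding k(2) using that psubset.hyps(1) by (intro Max_ge) auto
    define I' where "I' = {i\<in>I. ball (x i) (r i) \<inter> ball (x k) (r k) = {}}"
    have "k \<notin> I'" using psubset.prems[OF k(1)] unfolding I'_def by simp
    then have "I' \<subset> I" using k(1) unfolding I'_def by blast
    then obtain J where J: "J \<subseteq> I'" "disjoint_family_on (\<lambda>i. ball (x i) (r i)) J"
      "\<And>i. i \<in> I' \<Longrightarrow> \<exists>j\<in>J. ball (x i) (r i) \<subseteq> ball (x j) (3 * r j)"
      using psubset.IH[of I'] psubset.prems by blast
    show ?thesis
    proof (intro exI[of _ "insert k J"] conjI ballI)
      show "insert k J \<subseteq> I" using J(1) k(1) \<open>I' \<subset> I\<close> by blast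
      show "disjoint_family_on (\<lambda>i. ball (x i) (r i)) (insert k J)"
        using J(1,2) unfolding disjoint_family_on_def I'_def by blast
      fix i assume i: "i \<in> I"
      show "\<exists>j\<in>insert k J. ball (x i) (r i) \<subseteq> ball (x j) (3 * r j)"
      proof (cases "i \<in> I'")
        case True then show ?thesis using J(3) by blast
      next
        case False
        then obtain y where y: "dist (x i) y < r i" "dist (x k) y < r k"
          using i unfolding I'_def by auto
        have "dist (x k) z < 3 * r k" if "dist (x i) z < r i" for z
          using that y max[OF i] dist_triangle[of "x k" z y] dist_triangle[of y z "x i"]
          by (simp add: dist_commute)
        then show ?thesis by auto
      qed
    qed
  qed (auto simp: disjoint_family_on_def)
qed

lemma hausdorff_premeasure_le_finite_cover:
  fixes B :: "'i \<Rightarrow> 'a::metric_space set"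
  assumes "finite J" "X \<subseteq> (\<Union>j\<in>J. B j)" "0 \<le> \<epsilon>"
    and B: "\<And>j. j \<in> J \<Longrightarrow> bounded (B j)" "\<And>j. j \<in> J \<Longrightarrow> diameter (B j) \<le> \<epsilon>"
  shows "hausdorff_premeasure m \<epsilon> X \<le> (\<Sum>j\<in>J. diam_pow m (B j))"
proof -
  obtain e where e: "bij_betw e {..<card J} J"
    using ex_bij_betw_nat_finite[OF \<open>finite J\<close>] by (auto simp: atLeast0LessThan)
  \<comment> \<open>Padding with empty sets costs nothing, even in dimension \<open>0\<close>.\<close>
  define V where "V i = (if i < card J then B (e i) else {})" for i
  have eJ: "e i \<in> J" if "i < card J" for i using e that by (auto simp: bij_betw_def)
  have "hausdorff_premeasure m \<epsilon> X \<le> (\<Sum>i. diam_pow m (V i))"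
    unfolding hausdorff_premeasure_def
  proof (rule Inf_lower, intro CollectI exI[of _ V] conjI refl allI)
    show "X \<subseteq> (\<Union>i. V i)"
    proof
      fix x assume "x \<in> X"
      then obtain j where j: "j \<in> J" "x \<in> B j" using assms(2) by blast
      then obtain i where "i < card J" "j = e i" using e unfolding bij_betw_def by auto
      then show "x \<in> (\<Union>i. V i)" using j unfolding V_def by auto
    qed
  qed (use B eJ assms(3) in \<open>auto simp: V_def\<close>)
  also have "\<dots> = (\<Sum>i<card J. diam_pow m (V i))"
    by (rule suminf_finite) (auto simp: V_def diam_pow_def)
  also have "\<dots> = (\<Sum>i<card J. diam_pow m (B (e i)))" by (simp add: V_def)
  also have "\<dots> = (\<Sum>j\<in>J. diam_pow m (B j))" by (rule sum.reindex_bij_betw[OF e])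
  finally show ?thesis .
qed

lemma hausdorff_measure_empty: "hausdorff_measure m {} = 0"
proof -
  have "hausdorff_premeasure m \<epsilon> ({} :: 'a set) \<le> 0" if "0 < \<epsilon>" for \<epsilon>
    using hausdorff_premeasure_le_finite_cover[of "{}" "{}" "\<lambda>_. {}" \<epsilon> m] that by simp
  then have "hausdorff_measure m ({} :: 'a set) \<le> 0"
    unfolding hausdorff_measure_def by (intro SUP_least) simp
  then show ?thesis by simp
qed

text \<open>
In dimension \<open>0\<close> each nonempty covering set costs \<open>1\<close>. This case supplies an exponent when \<open>d < 0\<close>,
where the Hausdorff dimension of \<open>S\<close> may be \<open>0\<close>.
\<close>

lemma hausdorff_measure_zero_ne_0:
  assumes "S \<noteq> {}"
  shows "hausdorff_measure 0 S \<noteq> 0"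
proof -
  have "1 \<le> hausdorff_premeasure 0 1 S"
    unfolding hausdorff_premeasure_def
  proof (rule Inf_greatest, clarify)
    fix V :: "nat \<Rightarrow> 'a set" assume "S \<subseteq> (\<Union>i. V i)"
    then obtain i where "V i \<noteq> {}" using assms by fastforce
    then have "1 = (\<Sum>i\<in>{i}. diam_pow 0 (V i))" by (simp add: diam_pow_def)
    also have "\<dots> \<le> (\<Sum>i. diam_pow 0 (V i))" by (rule sum_le_suminf) auto
    finally show "1 \<le> (\<Sum>i. diam_pow 0 (V i))" .
  qed
  also have "\<dots> \<le> hausdorff_measure 0 S"
    unfolding hausdorff_measure_def by (rule SUP_upper) simp
  finally show ?thesis by auto
qed

lemma hausdorff_measure_ne_0:
  assumes "0 \<le> m" "ereal m < hausdorff_dim S"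
  shows "hausdorff_measure m S \<noteq> 0"
proof
  assume "hausdorff_measure m S = 0"
  moreover have "S \<noteq> {}" using assms(2) unfolding hausdorff_dim_def by auto
  ultimately have "hausdorff_dim S \<le> ereal m"
    using assms(1) unfolding hausdorff_dim_def by (auto intro!: Inf_lower)
  then show False using assms(2) by simp
qed

lemma diameter_ball_le:
  fixes p :: "'a::metric_space"
  assumes "0 \<le> t" shows "diameter (ball p t) \<le> 2 * t"
proof -
  have "dist y z \<le> 2 * t" if "y \<in> ball p t" "z \<in> ball p t" for y z
    using that dist_triangle3[of y z p] by simp
  then show ?thesis using assms unfolding diameter_def by (auto intro!: cSUP_least)
qed

text \<open>
A ball with \<open>C t\<^sup>m < M(B\<^sub>t(p))\<close> pays for its own \<open>m\<close>-dimensional size. Disjoint balls selected from a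
finite cover by such balls pay together at most the total mass, and their triples still cover \<open>S\<close>.
The bound on the total mass in terms of \<open>C\<close> and \<open>\<epsilon>\<close> forces all the radii to be small.
\<close>

lemma hausdorff_premeasure_le_of_dense_measure:
  fixes M :: "'a::metric_space measure"
  assumes sets: "sets M = sets borel" and "finite_measure M" and S: "compact S" and m: "0 < m"
    and C: "0 < C" and \<epsilon>: "0 < \<epsilon>" "measure M UNIV \<le> C * (\<epsilon> / 6) powr m"
    and dense: "\<And>p. p \<in> S \<Longrightarrow> \<exists>t>0. ennreal (C * t powr m) < emeasure M (ball p t)"
  shows "hausdorff_premeasure m \<epsilon> S \<le> ennreal (6 powr m * measure M UNIV / C)"
proof -
  interpret finite_measure M by fact
  have msr: "ball p t \<in> sets M" for p t using sets by simp
  have sp: "space M = UNIV" using sets_eq_imp_space_eq[OF sets] by simp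
  obtain t where t: "\<And>p. p \<in> S \<Longrightarrow> 0 < t p"
    "\<And>p. p \<in> S \<Longrightarrow> ennreal (C * t p powr m) < emeasure M (ball p (t p))"
    using dense by metis
  have t': "C * t p powr m \<le> measure M (ball p (t p))" if "p \<in> S" for p
    using t(2)[OF that] C unfolding emeasure_eq_measure by (simp add: ennreal_less_iff)
  have small: "6 * t p \<le> \<epsilon>" if "p \<in> S" for p
  proof -
    have "measure M (ball p (t p)) \<le> measure M UNIV" using msr sets by (intro finite_measure_mono) auto
    then have "C * t p powr m \<le> C * (\<epsilon> / 6) powr m" using t'[OF that] \<epsilon>(2) by linarith
    then have "t p powr m \<le> (\<epsilon> / 6) powr m" using C by simp
    then have "t p \<le> \<epsilon> / 6" using m t(1)[OF that] \<epsilon>(1)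
      by (meson not_le powr_less_mono2 less_imp_le divide_pos_pos zero_less_numeral)
    then show ?thesis by simp
  qed
  have "S \<subseteq> (\<Union>p\<in>S. ball p (t p))" using t(1) by force
  then obtain I where I: "I \<subseteq> S" "finite I" "S \<subseteq> (\<Union>p\<in>I. ball p (t p))"
    using compactE_image[OF S, of S "\<lambda>p. ball p (t p)"] by auto
  obtain J where J: "J \<subseteq> I" "disjoint_family_on (\<lambda>p. ball p (t p)) J"
    "\<And>p. p \<in> I \<Longrightarrow> \<exists>q\<in>J. ball p (t p) \<subseteq> ball q (3 * t q)"
    using finite_ball_selection[OF I(2), where r = t and x = "\<lambda>p. p"] t(1) I(1) by blast
  have fJ: "finite J" "J \<subseteq> S" using J(1) I finite_subset by blast+
  have "hausdorff_premeasure m \<epsilon> S \<le> (\<Sum>q\<in>J. diam_pow m (ball q (3 * t q)))"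
  proof (rule hausdorff_premeasure_le_finite_cover[OF fJ(1)])
    show "S \<subseteq> (\<Union>q\<in>J. ball q (3 * t q))" 
    proof
      fix x assume "x \<in> S"
      then obtain p where "p \<in> I" "x \<in> ball p (t p)" using I(3) by blast
      then show "x \<in> (\<Union>q\<in>J. ball q (3 * t q))" using J(3)[of p] by blast
    qed
    show "diameter (ball q (3 * t q)) \<le> \<epsilon>" if "q \<in> J" for q
      using diameter_ball_le[of "3 * t q" q] small[of q] t(1)[of q] fJ(2) that by fastforce
  qed (use \<epsilon> in auto)
  also have "\<dots> \<le> (\<Sum>q\<in>J. ennreal (6 powr m / C * measure M (ball q (t q))))"
  proof (rule sum_mono)
    fix q assume "q \<in> J"
    then have q: "q \<in> S" using fJ by blast
    have d: "0 \<le> diameter (ball q (3 * t q))" by (rule diameter_ge_0) simp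
    have "diameter (ball q (3 * t q)) \<le> 6 * t q"
      using diameter_ball_le[of "3 * t q" q] t(1)[OF q] by simp
    then have "diameter (ball q (3 * t q)) powr m \<le> (6 * t q) powr m"
      using m d by (intro powr_mono2) auto
    also have "\<dots> = 6 powr m * t q powr m" using t(1)[OF q] by (simp add: powr_mult)
    also have "\<dots> \<le> 6 powr m * (measure M (ball q (t q)) / C)"
      using t'[OF q] C by (intro mult_left_mono) (auto simp: field_simps)
    finally show "diam_pow m (ball q (3 * t q)) \<le> ennreal (6 powr m / C * measure M (ball q (t q)))"
      using m unfolding diam_pow_def by (auto intro!: ennreal_leI)
  qed
  also have "\<dots> = ennreal (6 powr m / C * (\<Sum>q\<in>J. measure M (ball q (t q))))"
    using C by (simp add: sum_distrib_left sum_ennreal)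
  also have "(\<Sum>q\<in>J. measure M (ball q (t q))) = measure M (\<Union>q\<in>J. ball q (t q))"
    using J(2) fJ(1) msr by (intro finite_measure_finite_Union[symmetric]) auto
  also have "\<dots> \<le> measure M UNIV" using sets fJ(1) by (intro finite_measure_mono) auto
  finally show ?thesis using C by (simp add: ennreal_leI mult_left_mono divide_right_mono)
qed

text \<open>
Otherwise the preceding estimate applies with every \<open>C\<close>, and \<open>C \<rightarrow> \<infinity>\<close> makes the Hausdorff measure
vanish. Since \<open>M\<close> is finite, the bound holds for all radii and not just for small ones.
\<close>

lemma exists_point_of_bounded_density:
  fixes M :: "'a::metric_space measure"
  assumes sets: "sets M = sets borel" and "finite_measure M" and S: "compact S" and m: "0 \<le> m"
    and pos: "hausdorff_measure m S \<noteq> 0"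
  shows "\<exists>p\<in>S. \<exists>C>0. \<forall>t>0. emeasure M (ball p t) \<le> ennreal (C * t powr m)"
proof (rule ccontr)
  interpret finite_measure M by fact
  assume "\<not> ?thesis"
  then have no: "\<exists>t>0. ennreal (C * t powr m) < emeasure M (ball p t)" if "p \<in> S" "0 < C" for p C
    using that by (metis not_le)
  have ne: "S \<noteq> {}" using pos hausdorff_measure_empty by blast
  have total: "emeasure M B \<le> ennreal (measure M UNIV)" for B
    unfolding emeasure_eq_measure
    using bounded_measure[of B] sets_eq_imp_space_eq[OF sets] by (simp add: ennreal_leI)
  show False
  proof (cases "m = 0")
    case True
    obtain p where "p \<in> S" using ne by blast
    then obtain t where "t > 0" "ennreal ((measure M UNIV + 1) * t powr m) < emeasure M (ball p t)"
      using no[of p "measure M UNIV + 1"] by (metis add_nonneg_pos measure_nonneg zero_less_one)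
    then have "ennreal ((measure M UNIV + 1) * t powr m) < ennreal (measure M UNIV)"
      using total[of "ball p t"] by (meson order.strict_trans2)
    then have "(measure M UNIV + 1) * t powr m < measure M UNIV"
      by (subst (asm) ennreal_less_iff) auto
    then show False using True \<open>t > 0\<close> by simp
  next
    case False
    then have m0: "0 < m" using m by simp
    have small: "hausdorff_premeasure m \<epsilon> S \<le> ennreal \<eta>" if "0 < \<epsilon>" "0 < \<eta>" for \<epsilon> \<eta>
    proof -
      \<comment> \<open>The second summand makes the radii small, the third one the sum of their powers.\<close>
      define C where "C = 1 + measure M UNIV / (\<epsilon> / 6) powr m + 6 powr m * measure M UNIV / \<eta>"
      have nn: "0 \<le> measure M UNIV / (\<epsilon> / 6) powr m" "0 \<le> 6 powr m * measure M UNIV / \<eta>"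
        using that by auto
      then have C: "0 < C" "measure M UNIV / (\<epsilon> / 6) powr m \<le> C" "6 powr m * measure M UNIV / \<eta> \<le> C"
        unfolding C_def by linarith+
      have "hausdorff_premeasure m \<epsilon> S \<le> ennreal (6 powr m * measure M UNIV / C)"
        using C that no
        by (intro hausdorff_premeasure_le_of_dense_measure[OF sets finite_measure_axioms S m0])
          (auto simp: pos_divide_le_eq)
      also have "\<dots> \<le> ennreal \<eta>"
        using C that by (intro ennreal_leI) (simp add: field_simps)
      finally show ?thesis .
    qed
    have "hausdorff_premeasure m \<epsilon> S \<le> 0" if "0 < \<epsilon>" for \<epsilon>
      by (rule ennreal_le_epsilon) (simp add: small that)
    then have "hausdorff_measure m S \<le> 0"
      unfolding hausdorff_measure_def by (intro SUP_least) simp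
    then show False using pos by simp
  qed
qed


section \<open>Dyadic estimates of potentials\<close>

text \<open>
A layer-cake estimate: where \<open>h\<close> is of the order \<open>a = b \<theta>\<^sup>k\<close>, the function \<open>f\<close> is at most \<open>a\<^sup>-\<^sup>s\<close>, and
the mass there is \<open>O(a\<^sup>m)\<close>, so the \<open>k\<close>-th shell contributes \<open>O(a\<^sup>m\<^sup>-\<^sup>s)\<close>. The ratio \<open>\<theta>\<close> is left open
because both directions occur: shells shrinking to the singularity of the kernel (\<open>\<theta> = 1/2\<close>, \<open>s < m\<close>)
and shells growing away from it (\<open>\<theta> = 2\<close>, \<open>m < s\<close>).
\<close>

lemma nn_integral_le_dyadic:
  assumes h[measurable]: "h \<in> borel_measurable N"
    and dens: "\<And>t. 0 < t \<Longrightarrow> emeasure N {u\<in>space N. h u < t} \<le> ennreal (C * t powr m)"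
    and C: "0 \<le> C" and b: "0 < b" and \<theta>: "0 < \<theta>" "\<theta> powr (m - s) < 1"
    and f: "AE u in N. \<exists>k. h u < 2 * (b * \<theta> ^ k) \<and> f u \<le> ennreal (1 / (b * \<theta> ^ k) powr s)"
  shows "(\<integral>\<^sup>+u. f u \<partial>N) \<le> ennreal (C * 2 powr m * b powr (m - s) / (1 - \<theta> powr (m - s)))"
proof -
  let ?a = "\<lambda>k::nat. b * \<theta> ^ k"
  let ?S = "\<lambda>k. {u\<in>space N. h u < 2 * ?a k}"
  have a: "0 < ?a k" for k using b \<theta>(1) by simp
  have scale: "1 / x powr s * (C * (2 * x) powr m) = C * 2 powr m * x powr (m - s)" if "0 < x" for x
    using that by (simp add: powr_mult powr_diff)
  have "(\<theta> ^ k) powr (m - s) = (\<theta> powr (m - s)) ^ k" for k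
    using \<theta>(1) by (induction k) (simp_all add: powr_mult)
  then have geometric: "?a k powr (m - s) = b powr (m - s) * (\<theta> powr (m - s)) ^ k" for k
    using b \<theta>(1) by (simp add: powr_mult)
  have "(\<integral>\<^sup>+u. f u \<partial>N) \<le> (\<integral>\<^sup>+u. (\<Sum>k. ennreal (1 / ?a k powr s) * indicator (?S k) u) \<partial>N)"
  proof (rule nn_integral_mono_AE, use f AE_space in eventually_elim)
    case (elim u)
    then obtain k where k: "h u < 2 * ?a k" "f u \<le> ennreal (1 / ?a k powr s)" by blast
    have "f u \<le> (\<Sum>j\<in>{k}. ennreal (1 / ?a j powr s) * indicator (?S j) u)" using k elim by simp
    also have "\<dots> \<le> (\<Sum>j. ennreal (1 / ?a j powr s) * indicator (?S j) u)"
      by (rule sum_le_suminf) auto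
    finally show ?case .
  qed
  also have "\<dots> = (\<Sum>k. ennreal (1 / ?a k powr s) * emeasure N (?S k))"
    by (subst nn_integral_suminf) (auto simp: nn_integral_cmult_indicator)
  also have "\<dots> \<le> (\<Sum>k. ennreal ((C * 2 powr m * b powr (m - s)) * (\<theta> powr (m - s)) ^ k))"
  proof (rule suminf_le)
    fix k
    have "ennreal (1 / ?a k powr s) * emeasure N (?S k)
        \<le> ennreal (1 / ?a k powr s) * ennreal (C * (2 * ?a k) powr m)"
      using dens[of "2 * ?a k"] a[of k] by (intro mult_left_mono) auto
    also have "\<dots> = ennreal (1 / ?a k powr s * (C * (2 * ?a k) powr m))"
      by (rule ennreal_mult[symmetric]) (use C in auto)
    also have "1 / ?a k powr s * (C * (2 * ?a k) powr m) = C * 2 powr m * ?a k powr (m - s)"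
      by (rule scale[OF a])
    also have "?a k powr (m - s) = b powr (m - s) * (\<theta> powr (m - s)) ^ k"
      by (rule geometric)
    finally show "ennreal (1 / ?a k powr s) * emeasure N (?S k)
        \<le> ennreal ((C * 2 powr m * b powr (m - s)) * (\<theta> powr (m - s)) ^ k)"
      by (simp add: mult.assoc)
  qed auto
  also have "\<dots> = ennreal ((C * 2 powr m * b powr (m - s)) * (1 / (1 - \<theta> powr (m - s))))"
    using C \<theta> by (intro suminf_ennreal_eq sums_mult geometric_sums) auto
  finally show ?thesis by simp
qed

lemma dyadic_scale_down:
  fixes h b :: real
  assumes "0 < h" "h < 2 * b"
  shows "\<exists>k. b * (1 / 2) ^ k \<le> h \<and> h < 2 * (b * (1 / 2) ^ k)"
proof -
  let ?P = "\<lambda>k::nat. b * (1 / 2) ^ k \<le> h"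
  have "0 < b" using assms by simp
  obtain k where "(1 / 2 :: real) ^ k < h / b"
    using real_arch_pow_inv[of "h / b" "1 / 2"] assms \<open>0 < b\<close> by auto
  then have ex: "?P k" using \<open>0 < b\<close> by (simp add: field_simps)
  define j where "j = (LEAST k. ?P k)"
  have j: "?P j" unfolding j_def by (rule LeastI[of ?P, OF ex])
  have "h < 2 * (b * (1 / 2) ^ j)"
  proof (cases j)
    case 0 then show ?thesis using assms by simp
  next
    case (Suc i)
    then have "\<not> ?P i" using not_less_Least[of i ?P] unfolding j_def by simp
    then show ?thesis using Suc by simp
  qed
  with j show ?thesis by blast
qed

lemma dyadic_scale_up:
  fixes h b :: real
  assumes "0 < b" "b \<le> h"
  shows "\<exists>k. b * 2 ^ k \<le> h \<and> h < 2 * (b * 2 ^ k)"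
proof -
  let ?P = "\<lambda>k::nat. h < 2 * (b * 2 ^ k)"
  obtain k where "h / b < 2 ^ k" using real_arch_pow[of 2 "h / b"] by auto
  then have ex: "?P k" using assms by (simp add: field_simps)
  define j where "j = (LEAST k. ?P k)"
  have j: "?P j" unfolding j_def by (rule LeastI[of ?P, OF ex])
  have "b * 2 ^ j \<le> h"
  proof (cases j)
    case 0 then show ?thesis using assms by simp
  next
    case (Suc i)
    then have "\<not> ?P i" using not_less_Least[of i ?P] unfolding j_def by simp
    then show ?thesis using Suc by simp
  qed
  with j show ?thesis by blast
qed

text \<open>
The singularity of the kernel carries no mass, so its infinite value there is harmless.
\<close>

lemma AE_pos_of_density:
  assumes h[measurable]: "h \<in> borel_measurable N" and h0: "\<And>u. u \<in> space N \<Longrightarrow> 0 \<le> h u"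
    and dens: "\<And>t. 0 < t \<Longrightarrow> emeasure N {u\<in>space N. h u < t} \<le> ennreal (C * t powr m)"
    and "0 < C" "0 < m"
  shows "AE u in N. 0 < h u"
proof -
  have "emeasure N {u\<in>space N. \<not> 0 < h u} \<le> 0"
  proof (rule ennreal_le_epsilon)
    fix e :: real assume e: "0 < e"
    define t where "t = (e / C) powr (1 / m)"
    have t: "0 < t" "C * t powr m = e" using e assms(4,5) unfolding t_def by (auto simp: powr_powr)
    have "emeasure N {u\<in>space N. \<not> 0 < h u} \<le> emeasure N {u\<in>space N. h u < t}"
      using t by (intro emeasure_mono) auto
    also have "\<dots> \<le> ennreal e" using dens[OF t(1)] t(2) by simp
    finally show "emeasure N {u\<in>space N. \<not> 0 < h u} \<le> 0 + ennreal e" by simp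
  qed
  then show ?thesis by (intro AE_I[of _ _ "{u\<in>space N. \<not> 0 < h u}"]) auto
qed

lemma riesz_kernel_measurable[measurable (raw)]:
  fixes f h :: "'b \<Rightarrow> 'a::{metric_space, second_countable_topology}"
  assumes [measurable]: "f \<in> borel_measurable M" "h \<in> borel_measurable M"
  shows "(\<lambda>x. riesz_kernel s (f x) (h x)) \<in> borel_measurable M"
proof -
  have "riesz_kernel s (f x) (h x) =
      (if dist (f x) (h x) = 0 then \<infinity> else ennreal (1 / dist (f x) (h x) powr s))" for x
    by (simp add: riesz_kernel_def)
  then show ?thesis by simp
qed

text \<open>
For \<open>y\<close> outside the enlarged annulus, \<open>d(x,y)\<close> is at least \<open>\<rho>/2\<close>, and at least \<open>d(y,p)/2\<close> once
\<open>d(y,p) \<ge> 4\<rho>\<close>. Measuring shells by \<open>h = d(p,y)/2\<close> turns this into the hypothesis of the dyadic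
estimate with \<open>b = \<rho>/4\<close> and \<open>\<theta> = 2\<close>.
\<close>

lemma far_potential_le:
  fixes M :: "'a::{metric_space, second_countable_topology} measure"
  assumes sets: "sets M = sets borel"
    and dens: "\<And>t. 0 < t \<Longrightarrow> emeasure M (ball p t) \<le> ennreal (C * t powr m)"
    and C: "0 \<le> C" and m: "m < s" and s: "0 < s"
    and x: "0 < \<rho>" "\<rho> \<le> dist x p" "dist x p \<le> 2 * \<rho>"
  shows "(\<integral>\<^sup>+y. riesz_kernel s x y * indicator (- {y. dist y p \<in> {\<rho> / 2 <..< 4 * \<rho>}}) y \<partial>M)
    \<le> ennreal (C * 2 powr m * 2 powr m * 4 powr (s - m) / (1 - 2 powr (m - s)) * \<rho> powr (m - s))"
proof -
  let ?h = "\<lambda>y. dist p y / 2" and ?b = "\<rho> / 4"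
  let ?f = "\<lambda>y. riesz_kernel s x y * indicator (- {y. dist y p \<in> {\<rho> / 2 <..< 4 * \<rho>}}) y"
  have sp: "space M = UNIV" using sets_eq_imp_space_eq[OF sets] by simp
  have [measurable]: "(\<lambda>y. y) \<in> measurable M borel"
    using measurable_ident_sets[OF sets] by (simp add: id_def)
  have hm: "?h \<in> borel_measurable M" by measurable
  have hd: "emeasure M {u\<in>space M. ?h u < t} \<le> ennreal (C * 2 powr m * t powr m)" if t: "0 < t" for t
  proof -
    have "{u\<in>space M. ?h u < t} = ball p (2 * t)" unfolding sp by auto
    then show ?thesis using dens[of "2 * t"] t by (simp add: powr_mult mult.assoc)
  qed
  have kernel: "riesz_kernel s x y \<le> ennreal (1 / a powr s)" if "0 < a" "a \<le> dist x y" for a y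
    using that s unfolding riesz_kernel_def
    by (auto intro!: ennreal_leI divide_left_mono powr_mono2)
  have "\<exists>k. ?h y < 2 * (?b * 2 ^ k) \<and> ?f y \<le> ennreal (1 / (?b * 2 ^ k) powr s)" for y
  proof (cases "?h y < 2 * ?b")
    case True
    have "?f y \<le> ennreal (1 / ?b powr s)"
    proof (cases "dist y p \<in> {\<rho> / 2 <..< 4 * \<rho>}")
      case False
      then have "dist y p \<le> \<rho> / 2" using True x(1) by (auto simp: dist_commute)
      then have "?b \<le> dist x y" using x dist_triangle2[of x p y] by (simp add: dist_commute)
      then show ?thesis using kernel[of ?b y] x(1) False by simp
    qed simp
    then show ?thesis using True by (intro exI[of _ 0]) simp
  next
    case False
    then obtain k where k: "?b * 2 ^ k \<le> ?h y" "?h y < 2 * (?b * 2 ^ k)"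
      using dyadic_scale_up[of ?b "?h y"] x(1) by auto
    have "?f y \<le> ennreal (1 / (?b * 2 ^ k) powr s)"
    proof (cases "dist y p \<in> {\<rho> / 2 <..< 4 * \<rho>}")
      case out: False
      then have "4 * \<rho> \<le> dist y p" using False x(1) by (auto simp: dist_commute)
      then have "?h y \<le> dist x y"
        using x dist_triangle[of y p x] by (simp add: dist_commute)
      then show ?thesis using kernel[of "?b * 2 ^ k" y] k(1) x(1) out by simp
    qed simp
    then show ?thesis using k(2) by blast
  qed
  then have "(\<integral>\<^sup>+y. ?f y \<partial>M) \<le> ennreal (C * 2 powr m * 2 powr m * ?b powr (m - s) / (1 - 2 powr (m - s)))"
    using C x(1) m powr_less_mono[of "m - s" 0 2]
    by (intro nn_integral_le_dyadic[OF hm hd]) auto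
  also have "?b powr (m - s) = 4 powr (s - m) * \<rho> powr (m - s)"
    using x(1) powr_minus[of 4 "s - m"] by (simp add: powr_divide powr_minus_divide field_simps)
  finally show ?thesis by (simp add: mult.assoc)
qed


section \<open>Two bounds for the capacity\<close>

lemma radon_measure_onD:
  assumes "radon_measure_on U \<nu>"
  shows "sets \<nu> = sets (restrict_space borel U)" and "space \<nu> = U"
    and "(\<lambda>y. y) \<in> measurable \<nu> borel"
proof -
  show sets: "sets \<nu> = sets (restrict_space borel U)"
    using assms[unfolded radon_measure_on_def] by (rule conjunct1)
  show "space \<nu> = U" using sets_eq_imp_space_eq[OF sets] by (simp add: space_restrict_space)
  show "(\<lambda>y. y) \<in> measurable \<nu> borel"
    by (subst measurable_cong_sets[OF sets refl], rule measurable_restrict_space1) simp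
qed

text \<open>
Integrate the potential of a competitor \<open>\<nu>\<close>, which is at least \<open>1\<close> on \<open>E\<close>, against the image of \<open>N\<close>
under \<open>F\<close>, and exchange the integrals: the mass of \<open>N\<close> is at most \<open>B \<nu>(U)\<close>. Keeping \<open>N\<close> and \<open>F\<close>
apart lets the test measure on a geodesic sphere be described on a Euclidean ball.
\<close>

lemma capacity_ge_of_test_measure:
  fixes F :: "'b \<Rightarrow> 'a::{metric_space, second_countable_topology}"
  assumes N: "finite_measure N" and F[measurable]: "F \<in> borel_measurable N"
    and E: "\<And>u. u \<in> space N \<Longrightarrow> F u \<in> E" and B: "0 < B"
    and pot: "\<And>y. y \<in> U \<Longrightarrow> (\<integral>\<^sup>+u. riesz_kernel (real n - \<alpha>) (F u) y \<partial>N) \<le> ennreal B"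
  shows "emeasure N (space N) / ennreal B \<le> capacity n \<alpha> E U"
  unfolding capacity_def
proof (rule Inf_greatest)
  fix w
  assume "w \<in> {emeasure \<nu> U |\<nu>. radon_measure_on U \<nu> \<and> (\<forall>x\<in>E. 1 \<le> riesz_potential n \<alpha> \<nu> x)}"
  then obtain \<nu> :: "'a measure" where w: "w = emeasure \<nu> U"
    and \<nu>: "radon_measure_on U \<nu>" "\<forall>x\<in>E. 1 \<le> riesz_potential n \<alpha> \<nu> x" by blast
  note sp = radon_measure_onD(2)[OF \<nu>(1)] and id[measurable] = radon_measure_onD(3)[OF \<nu>(1)]
  have "emeasure N (space N) / ennreal B \<le> emeasure \<nu> U"
  proof (cases "emeasure \<nu> U = \<infinity>")
    case False
    interpret N: finite_measure N by fact
    interpret \<nu>: finite_measure \<nu> by (rule finite_measureI) (use False sp in simp)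
    interpret pair_sigma_finite N \<nu> ..
    have [measurable]: "(\<lambda>z. riesz_kernel (real n - \<alpha>) (F (fst z)) (snd z)) \<in> borel_measurable (N \<Otimes>\<^sub>M \<nu>)"
    proof (rule riesz_kernel_measurable)
      show "(\<lambda>z. snd z) \<in> borel_measurable (N \<Otimes>\<^sub>M \<nu>)"
        using measurable_compose[OF measurable_snd id] .
    qed measurable
    have "emeasure N (space N) = (\<integral>\<^sup>+u. 1 \<partial>N)" by simp
    also have "\<dots> \<le> (\<integral>\<^sup>+u. (\<integral>\<^sup>+y. riesz_kernel (real n - \<alpha>) (F u) y \<partial>\<nu>) \<partial>N)"
      using \<nu>(2) E unfolding riesz_potential_def by (intro nn_integral_mono) blast
    also have "\<dots> = (\<integral>\<^sup>+y. (\<integral>\<^sup>+u. riesz_kernel (real n - \<alpha>) (F u) y \<partial>N) \<partial>\<nu>)"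
      using Fubini[of "\<lambda>z. riesz_kernel (real n - \<alpha>) (F (fst z)) (snd z)"] by simp
    also have "\<dots> \<le> (\<integral>\<^sup>+y. ennreal B \<partial>\<nu>)" using pot sp by (intro nn_integral_mono) auto
    also have "\<dots> = ennreal B * emeasure \<nu> U" by (simp add: sp)
    finally show ?thesis using B by (intro divide_le_posI_ennreal) auto
  qed simp
  then show "emeasure N (space N) / ennreal B \<le> w" unfolding w .
qed

text \<open>
The restriction of \<open>\<mu>\<close> to \<open>\<Omega>\<close>, divided by \<open>l\<close>, competes in the definition of the capacity.
\<close>

lemma capacity_le_of_near_potential:
  fixes \<mu> :: "'a::{metric_space, second_countable_topology} measure"
  assumes \<mu>: "radon_measure_on G \<mu>" and \<Omega>: "open \<Omega>" "\<Omega> \<subseteq> G" and l: "0 < l"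
    and E: "\<And>x. x \<in> E \<Longrightarrow> ennreal l \<le> (\<integral>\<^sup>+y. riesz_kernel (real n - \<alpha>) x y * indicator \<Omega> y \<partial>\<mu>)"
  shows "capacity n \<alpha> E \<Omega> \<le> ennreal (1 / l) * emeasure \<mu> \<Omega>"
proof -
  note sets = radon_measure_onD(1)[OF \<mu>] and id = radon_measure_onD(3)[OF \<mu>]
  have \<mu>fin: "\<And>K. compact K \<Longrightarrow> K \<subseteq> G \<Longrightarrow> emeasure \<mu> K < \<infinity>"
    and \<mu>reg: "\<And>B. B \<in> sets \<mu> \<Longrightarrow> emeasure \<mu> B = (SUP K\<in>{K. compact K \<and> K \<subseteq> B}. emeasure \<mu> K)"
    using \<mu> unfolding radon_measure_on_def by simp_all
  have "\<Omega> = G \<inter> \<Omega>" using \<Omega> by blast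
  then have \<Omega>m: "\<Omega> \<in> sets \<mu>" unfolding sets sets_restrict_space using \<Omega>(1) by (intro image_eqI[of _ _ \<Omega>]) auto
  define \<nu> where "\<nu> = scale_measure (ennreal (1 / l)) (restrict_space \<mu> \<Omega>)"
  have setsr: "sets (restrict_space \<mu> \<Omega>) = sets (restrict_space borel \<Omega>)"
    using \<Omega> by (simp add: sets_restrict_space sets image_image Int_assoc[symmetric] inf.absorb1)
  have sub: "B \<in> sets \<mu>" "B \<subseteq> \<Omega>" if "B \<in> sets (restrict_space \<mu> \<Omega>)" for B
    using that \<Omega>m by (auto simp: sets_restrict_space)
  have em: "emeasure \<nu> B = ennreal (1 / l) * emeasure \<mu> B" if "B \<subseteq> \<Omega>" for B
    unfolding \<nu>_def emeasure_scale_measure using that \<Omega>m by (subst emeasure_restrict_space) auto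
  have "radon_measure_on \<Omega> \<nu>"
    unfolding radon_measure_on_def
  proof (intro conjI allI impI ballI)
    show "sets \<nu> = sets (restrict_space borel \<Omega>)" unfolding \<nu>_def using setsr by simp
    show "emeasure \<nu> K < \<infinity>" if "compact K \<and> K \<subseteq> \<Omega>" for K
      using that \<mu>fin[of K] \<Omega>(2) by (subst em) (auto simp: ennreal_mult_less_top)
    fix B assume "B \<in> sets \<nu>"
    then have B: "B \<in> sets \<mu>" "B \<subseteq> \<Omega>" using sub unfolding \<nu>_def by auto
    show "emeasure \<nu> B = (SUP K\<in>{K. compact K \<and> K \<subseteq> B}. emeasure \<nu> K)"
      unfolding em[OF B(2)] \<mu>reg[OF B(1)] SUP_mult_left_ennreal
      using B(2) by (intro SUP_cong refl) (auto intro!: em[symmetric])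
  qed
  moreover have "1 \<le> riesz_potential n \<alpha> \<nu> x" if "x \<in> E" for x
  proof -
    have "(\<lambda>y. riesz_kernel (real n - \<alpha>) x y) \<in> borel_measurable \<mu>"
      by (rule riesz_kernel_measurable[OF _ id]) simp
    then have km: "(\<lambda>y. riesz_kernel (real n - \<alpha>) x y) \<in> borel_measurable (restrict_space \<mu> \<Omega>)"
      by (rule measurable_restrict_space1)
    have "riesz_potential n \<alpha> \<nu> x =
        ennreal (1 / l) * (\<integral>\<^sup>+y. riesz_kernel (real n - \<alpha>) x y * indicator \<Omega> y \<partial>\<mu>)"
      unfolding riesz_potential_def \<nu>_def nn_integral_scale_measure[OF km]
      using \<Omega>m by (subst nn_integral_restrict_space) auto
    moreover have "ennreal (1 / l) * ennreal l \<le> \<dots>" using E[OF that] by (rule mult_left_mono) simp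
    moreover have "ennreal (1 / l) * ennreal l = 1" using l by (simp flip: ennreal_mult)
    ultimately show ?thesis by simp
  qed
  ultimately have "capacity n \<alpha> E \<Omega> \<le> emeasure \<nu> \<Omega>"
    unfolding capacity_def by (intro Inf_lower) blast
  then show ?thesis using em[of \<Omega>] by simp
qed


section \<open>The Riemannian metric in coordinates\<close>

lemma smooth_metric_tensorD:
  assumes "smooth_metric_tensor A g" "c \<in> A"
  shows "x \<in> fst c \<Longrightarrow> bilinear (g c x)"
    and "x \<in> fst c \<Longrightarrow> v \<noteq> 0 \<Longrightarrow> 0 < g c x v v"
    and "smooth_on (snd c ` fst c) (\<lambda>u. g c (chart_inv c u) v w)"
    and "c' \<in> A \<Longrightarrow> x \<in> fst c \<inter> fst c' \<Longrightarrow>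
      g c x v w = g c' x (frechet_derivative (snd c' \<circ> chart_inv c) (at (snd c x)) v)
                         (frechet_derivative (snd c' \<circ> chart_inv c) (at (snd c x)) w)"
  using assms unfolding smooth_metric_tensor_def Let_def by blast+

lemma smooth_atlasD:
  assumes "smooth_atlas A"
  shows "\<exists>c\<in>A. x \<in> fst c"
    and "c \<in> A \<Longrightarrow> open (fst c)"
    and "c \<in> A \<Longrightarrow> open (snd c ` fst c)"
    and "c \<in> A \<Longrightarrow> continuous_on (fst c) (snd c)"
    and "c \<in> A \<Longrightarrow> continuous_on (snd c ` fst c) (chart_inv c)"
    and "c \<in> A \<Longrightarrow> x \<in> fst c \<Longrightarrow> chart_inv c (snd c x) = x"
    and "c \<in> A \<Longrightarrow> u \<in> snd c ` fst c \<Longrightarrow> snd c (chart_inv c u) = u"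
    and "c \<in> A \<Longrightarrow> u \<in> snd c ` fst c \<Longrightarrow> chart_inv c u \<in> fst c"
    and "c \<in> A \<Longrightarrow> c' \<in> A \<Longrightarrow> smooth_on (snd c ` (fst c \<inter> fst c')) (snd c' \<circ> chart_inv c)"
proof -
  show "\<exists>c\<in>A. x \<in> fst c" using assms unfolding smooth_atlas_def by blast
  show "c \<in> A \<Longrightarrow> open (fst c)" "c \<in> A \<Longrightarrow> open (snd c ` fst c)"
    "c \<in> A \<Longrightarrow> c' \<in> A \<Longrightarrow> smooth_on (snd c ` (fst c \<inter> fst c')) (snd c' \<circ> chart_inv c)"
    using assms unfolding smooth_atlas_def by blast+
  have h: "c \<in> A \<Longrightarrow> homeomorphism (fst c) (snd c ` fst c) (snd c) (chart_inv c)"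
    using assms unfolding smooth_atlas_def by blast
  show "c \<in> A \<Longrightarrow> continuous_on (fst c) (snd c)"
    "c \<in> A \<Longrightarrow> continuous_on (snd c ` fst c) (chart_inv c)"
    "c \<in> A \<Longrightarrow> x \<in> fst c \<Longrightarrow> chart_inv c (snd c x) = x"
    "c \<in> A \<Longrightarrow> u \<in> snd c ` fst c \<Longrightarrow> snd c (chart_inv c u) = u"
    "c \<in> A \<Longrightarrow> u \<in> snd c ` fst c \<Longrightarrow> chart_inv c u \<in> fst c"
    using h unfolding homeomorphism_def by blast+
qed

lemma smooth_onD:
  assumes "smooth_on X f"
  shows "continuous_on X f"
    and "x \<in> X \<Longrightarrow> f differentiable (at x)"
    and "continuous_on X (\<lambda>x. frechet_derivative f (at x) v)"
proof -
  have "Ck_on 0 X f" "Ck_on (Suc 0) X f" using assms unfolding smooth_on_def by blast+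
  then show "continuous_on X f" "x \<in> X \<Longrightarrow> f differentiable (at x)"
    "continuous_on X (\<lambda>x. frechet_derivative f (at x) v)" by auto
qed

lemma bilinear_axis_expansion:
  fixes B :: "real ^ 'n::finite \<Rightarrow> real ^ 'n \<Rightarrow> real"
  assumes "bilinear B"
  shows "B v w = (\<Sum>i\<in>UNIV. \<Sum>j\<in>UNIV. v $ i * w $ j * B (axis i 1) (axis j 1))"
proof -
  have e: "(\<Sum>i\<in>UNIV. x $ i *\<^sub>R axis i 1) = x" for x :: "real ^ 'n"
    using basis_expansion[of x] by (simp add: scalar_mult_eq_scaleR)
  have "B v w = B (\<Sum>i\<in>UNIV. v $ i *\<^sub>R axis i 1) (\<Sum>j\<in>UNIV. w $ j *\<^sub>R axis j 1)"
    by (simp add: e)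
  also have "\<dots> = (\<Sum>(i,j)\<in>UNIV \<times> UNIV. B (v $ i *\<^sub>R axis i 1) (w $ j *\<^sub>R axis j 1))"
    by (rule bilinear_sum[OF assms])
  also have "\<dots> = (\<Sum>i\<in>UNIV. \<Sum>j\<in>UNIV. v $ i * w $ j * B (axis i 1) (axis j 1))"
    unfolding sum.cartesian_product[symmetric]
    by (simp add: bilinear_lmul[OF assms] bilinear_rmul[OF assms] mult.assoc mult.left_commute)
  finally show ?thesis .
qed

text \<open>
Smoothness of the metric is given for fixed vectors only; expanding in the standard basis yields
joint continuity in the base point and the vector.
\<close>

lemma continuous_on_metric_tensor:
  fixes g :: "('a::topological_space, 'n::finite) metric_tensor"
  assumes g: "smooth_metric_tensor A g" and c: "c \<in> A"
    and f: "continuous_on T f" "f ` T \<subseteq> snd c ` fst c" and D: "continuous_on T D"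
  shows "continuous_on T (\<lambda>t. g c (chart_inv c (f t)) (D t) (D t))"
proof -
  have mem: "chart_inv c (f t) \<in> fst c" if "t \<in> T" for t
    using f(2) that unfolding chart_inv_def by (meson image_subset_iff inv_into_into)
  have "continuous_on (snd c ` fst c) (\<lambda>u. g c (chart_inv c u) v w)" for v w
    using smooth_onD(1)[OF smooth_metric_tensorD(3)[OF g c]] .
  then have cf: "continuous_on T (\<lambda>t. g c (chart_inv c (f t)) v w)" for v w
    using continuous_on_compose2[OF _ f(1) f(2)] by blast
  have "continuous_on T (\<lambda>t. \<Sum>i\<in>UNIV. \<Sum>j\<in>UNIV.
      D t $ i * D t $ j * g c (chart_inv c (f t)) (axis i 1) (axis j 1))"
    by (intro continuous_intros cf D)
  moreover have "g c (chart_inv c (f t)) (D t) (D t) = (\<Sum>i\<in>UNIV. \<Sum>j\<in>UNIV.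
      D t $ i * D t $ j * g c (chart_inv c (f t)) (axis i 1) (axis j 1))" if "t \<in> T" for t
    by (rule bilinear_axis_expansion[OF smooth_metric_tensorD(1)[OF g c mem[OF that]]])
  ultimately show ?thesis by (simp cong: continuous_on_cong)
qed

text \<open>
By homogeneity it suffices to consider unit vectors, and there the quadratic form is continuous and
positive on a compact set.
\<close>

lemma metric_norm_comparable:
  fixes g :: "('a::topological_space, 'n::finite) metric_tensor"
  assumes g: "smooth_metric_tensor A g" and c: "c \<in> A"
    and K: "compact K" "K \<subseteq> snd c ` fst c"
  obtains m M where "0 < m" "0 < M"
    "\<And>u v. u \<in> K \<Longrightarrow> m * norm v \<le> sqrt (g c (chart_inv c u) v v)"
    "\<And>u v. u \<in> K \<Longrightarrow> sqrt (g c (chart_inv c u) v v) \<le> M * norm v"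
proof (cases "K = {}")
  case True then show ?thesis using that[of 1 1] by auto
next
  case False
  let ?S = "K \<times> sphere (0::real^'n) 1"
  let ?q = "\<lambda>z. sqrt (g c (chart_inv c (fst z)) (snd z) (snd z))"
  have mem: "chart_inv c u \<in> fst c" if "u \<in> K" for u
    using K(2) that unfolding chart_inv_def by (meson subsetD inv_into_into)
  have cont: "continuous_on ?S ?q"
    using K(2) by (intro continuous_on_real_sqrt continuous_on_metric_tensor[OF g c] continuous_intros) auto
  have "sphere (0::real^'n) 1 \<noteq> {}" by simp
  then have ne: "?S \<noteq> {}" using False by auto
  have cS: "compact ?S" by (intro compact_Times K) auto
  have pos: "0 < ?q z" if "z \<in> ?S" for z
  proof -
    have "snd z \<noteq> 0" "fst z \<in> K" using that by (auto simp: mem_sphere)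
    then show ?thesis using smooth_metric_tensorD(2)[OF g c mem] by simp
  qed
  obtain z1 where z1: "z1 \<in> ?S" "\<forall>y\<in>?S. ?q z1 \<le> ?q y"
    using continuous_attains_inf[OF cS ne cont] by blast
  obtain z2 where z2: "z2 \<in> ?S" "\<forall>y\<in>?S. ?q y \<le> ?q z2"
    using continuous_attains_sup[OF cS ne cont] by blast
  have scale: "sqrt (g c (chart_inv c u) v v) = norm v * ?q (u, sgn v)"
    if "u \<in> K" for u v
  proof -
    have bil: "bilinear (g c (chart_inv c u))" using smooth_metric_tensorD(1)[OF g c mem[OF that]] .
    have "v = norm v *\<^sub>R sgn v" by (cases "v = 0") (simp_all add: sgn_div_norm)
    then have "g c (chart_inv c u) v v = g c (chart_inv c u) (norm v *\<^sub>R sgn v) (norm v *\<^sub>R sgn v)"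
      by metis
    also have "\<dots> = norm v * (norm v * g c (chart_inv c u) (sgn v) (sgn v))"
      by (simp only: bilinear_lmul[OF bil] bilinear_rmul[OF bil] real_scaleR_def)
    finally show ?thesis by (simp add: real_sqrt_mult mult.assoc[symmetric])
  qed
  show ?thesis
  proof (rule that[of "?q z1" "?q z2"])
    show "0 < ?q z1" "0 < ?q z2" using pos z1 z2 by blast+
    fix u v assume u: "u \<in> K"
    show "?q z1 * norm v \<le> sqrt (g c (chart_inv c u) v v)"
      using z1(2)[rule_format, of "(u, sgn v)"] u unfolding scale[OF u]
      by (cases "v = 0") (auto simp: norm_sgn mult.commute intro!: mult_left_mono)
    show "sqrt (g c (chart_inv c u) v v) \<le> ?q z2 * norm v"
      using z2(2)[rule_format, of "(u, sgn v)"] u unfolding scale[OF u]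
      by (cases "v = 0") (auto simp: norm_sgn mult.commute intro!: mult_left_mono)
  qed
qed


section \<open>Speed and length of piecewise smooth curves\<close>

text \<open>
The chart in \<open>curve_speed\<close> comes from a choice operator. The chain rule for the change of coordinates
and the transformation law of the metric cancel, so any other chart gives the same speed.
\<close>

lemma curve_speed_in_chart:
  fixes \<gamma> :: "real \<Rightarrow> 'a::topological_space" and A :: "('a, 'n::finite) chart set"
  assumes A: "smooth_atlas A" and g: "smooth_metric_tensor A g"
    and c: "c \<in> A" and t: "\<gamma> t \<in> fst c" "isCont \<gamma> t"
    and v: "((snd c \<circ> \<gamma>) has_vector_derivative v) (at t)"
  shows "curve_speed A g \<gamma> t = sqrt (g c (\<gamma> t) v v)"
proof -
  define c' where "c' = (SOME c. c \<in> A \<and> \<gamma> t \<in> fst c)"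
  have c': "c' \<in> A" "\<gamma> t \<in> fst c'"
    using someI[of "\<lambda>c. c \<in> A \<and> \<gamma> t \<in> fst c" c] c t(1) unfolding c'_def by blast+
  let ?T = "snd c' \<circ> chart_inv c"
  let ?D = "frechet_derivative ?T (at (snd c (\<gamma> t)))"
  have "?T differentiable (at (snd c (\<gamma> t)))"
    using smooth_onD(2)[OF smooth_atlasD(9)[OF A c c'(1)]] t(1) c'(2) by blast
  then have "(?T has_derivative ?D) (at ((snd c \<circ> \<gamma>) t))"
    by (simp add: frechet_derivative_works)
  then have d: "((?T \<circ> (snd c \<circ> \<gamma>)) has_vector_derivative ?D v) (at t)"
    using vector_derivative_diff_chain_within[OF v] has_derivative_at_withinI by blast
  have "open (fst c)" using smooth_atlasD(2)[OF A c] .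
  then obtain e where e: "0 < e" "\<And>s. dist s t < e \<Longrightarrow> \<gamma> s \<in> fst c"
    using t unfolding continuous_at_open by (metis open_dist)
  have "((snd c' \<circ> \<gamma>) has_vector_derivative ?D v) (at t)"
    by (rule has_vector_derivative_transform_within[OF d e(1)])
      (auto simp: smooth_atlasD(6)[OF A c] dest!: e(2))
  then have vd: "vector_derivative (snd c' \<circ> \<gamma>) (at t) = ?D v" by (rule vector_derivative_at)
  show ?thesis
    unfolding curve_speed_def Let_def c'_def[symmetric] vd
    using smooth_metric_tensorD(4)[OF g c c'(1), of "\<gamma> t" v v] t(1) c'(2) by auto
qed

lemma curve_speed_nonneg:
  assumes A: "smooth_atlas A" and g: "smooth_metric_tensor A g"
  shows "0 \<le> curve_speed A g \<gamma> t"
proof -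
  define c where "c = (SOME c. c \<in> A \<and> \<gamma> t \<in> fst c)"
  have c: "c \<in> A" "\<gamma> t \<in> fst c"
    using someI_ex[of "\<lambda>c. c \<in> A \<and> \<gamma> t \<in> fst c"] smooth_atlasD(1)[OF A, of "\<gamma> t"]
    unfolding c_def by blast+
  have "0 \<le> g c (\<gamma> t) v v" for v
    using smooth_metric_tensorD(2)[OF g c, of v] bilinear_lzero[OF smooth_metric_tensorD(1)[OF g c], of v]
    by (cases "v = 0") auto
  then show ?thesis unfolding curve_speed_def Let_def c_def[symmetric] by simp
qed

text \<open>
A non-integrable speed would give the length \<open>0\<close>, the default value of the integral.
\<close>

lemma curve_length_nonneg:
  assumes A: "smooth_atlas A" and g: "smooth_metric_tensor A g"
  shows "0 \<le> curve_length A g \<gamma>"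
  unfolding curve_length_def
  by (cases "curve_speed A g \<gamma> integrable_on {0..1}")
    (auto intro!: integral_nonneg curve_speed_nonneg[OF assms] simp: not_integrable_integral)

lemma C1_curve_chart_derivative:
  fixes \<gamma> :: "real \<Rightarrow> 'a::topological_space" and A :: "('a, 'n::finite) chart set"
  assumes A: "smooth_atlas A" and g: "smooth_metric_tensor A g"
    and \<gamma>: "C1_curve_on A a b \<gamma>" and c: "c \<in> A"
  shows "\<exists>D. continuous_on {t\<in>{a..b}. \<gamma> t \<in> fst c} D \<and>
    (\<forall>t\<in>{a<..<b}. \<gamma> t \<in> fst c \<longrightarrow>
      ((snd c \<circ> \<gamma>) has_vector_derivative D t) (at t) \<and>
      curve_speed A g \<gamma> t = sqrt (g c (\<gamma> t) (D t) (D t)))"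
proof -
  obtain D where D: "continuous_on {t\<in>{a..b}. \<gamma> t \<in> fst c} D"
    "\<forall>t\<in>{a..b}. \<gamma> t \<in> fst c \<longrightarrow> ((snd c \<circ> \<gamma>) has_vector_derivative D t) (at t within {a..b})"
    using \<gamma> c unfolding C1_curve_on_def by blast
  have within: "at t within {a..b} = at t" if "t \<in> {a<..<b}" for t
    using that by (simp add: at_within_Icc_at)
  show ?thesis
  proof (intro exI[of _ D] conjI D(1) ballI impI)
    fix t assume t: "t \<in> {a<..<b}" "\<gamma> t \<in> fst c"
    have tt: "t \<in> {a..b}" using t(1) by auto
    show v: "((snd c \<circ> \<gamma>) has_vector_derivative D t) (at t)"
      using D(2) t tt unfolding within[OF t(1), symmetric] by blast
    have "continuous (at t within {a..b}) \<gamma>"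
      using \<gamma> tt unfolding C1_curve_on_def continuous_on_eq_continuous_within by blast
    then have "isCont \<gamma> t" unfolding within[OF t(1)] .
    then show "curve_speed A g \<gamma> t = sqrt (g c (\<gamma> t) (D t) (D t))"
      by (rule curve_speed_in_chart[OF A g c t(2) _ v])
  qed
qed

text \<open>
Near each parameter the speed agrees, except possibly at the end points of the interval, with a
continuous function read off in one chart, and integrability is a local property.
\<close>

lemma curve_speed_integrable_C1:
  fixes \<gamma> :: "real \<Rightarrow> 'a::topological_space" and A :: "('a, 'n::finite) chart set"
  assumes A: "smooth_atlas A" and g: "smooth_metric_tensor A g" and \<gamma>: "C1_curve_on A a b \<gamma>"
  shows "curve_speed A g \<gamma> integrable_on {a..b}"
proof -
  have "\<exists>d>0. \<forall>u v. x \<in> cbox u v \<and> cbox u v \<subseteq> ball x d \<and> cbox u v \<subseteq> cbox a b \<longrightarrow>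
      curve_speed A g \<gamma> integrable_on cbox u v" if x: "x \<in> cbox a b" for x
  proof -
    obtain c where c: "c \<in> A" "\<gamma> x \<in> fst c" using smooth_atlasD(1)[OF A] by blast
    obtain D where D: "continuous_on {t\<in>{a..b}. \<gamma> t \<in> fst c} D"
      "\<And>t. t \<in> {a<..<b} \<Longrightarrow> \<gamma> t \<in> fst c \<Longrightarrow> curve_speed A g \<gamma> t = sqrt (g c (\<gamma> t) (D t) (D t))"
      using C1_curve_chart_derivative[OF A g \<gamma> c(1)] by blast
    have cont: "continuous_on {a..b} \<gamma>" using \<gamma> unfolding C1_curve_on_def by blast
    obtain d where d: "d > 0" "\<And>t. t \<in> {a..b} \<Longrightarrow> dist x t < d \<Longrightarrow> \<gamma> t \<in> fst c"
    proof -
      have "open (fst c)" using smooth_atlasD(2)[OF A c(1)] .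
      then obtain B where B: "open B" "x \<in> B" "\<forall>y\<in>{a..b}. y \<in> B \<longrightarrow> \<gamma> y \<in> fst c"
        using cont[unfolded continuous_on_topological] x c(2) by (metis box_real(2))
      then obtain d where "d > 0" "ball x d \<subseteq> B" using open_contains_ball by blast
      then show ?thesis using that[of d] B by (auto simp: subset_iff)
    qed
    have "curve_speed A g \<gamma> integrable_on cbox u v"
      if uv: "x \<in> cbox u v" "cbox u v \<subseteq> ball x d" "cbox u v \<subseteq> cbox a b" for u v
    proof -
      have sub: "{u..v} \<subseteq> {t\<in>{a..b}. \<gamma> t \<in> fst c}" using uv d(2) by (auto simp: subset_iff)
      have "continuous_on {u..v} (\<lambda>t. sqrt (g c (chart_inv c (snd c (\<gamma> t))) (D t) (D t)))"
      proof (intro continuous_on_real_sqrt continuous_on_metric_tensor[OF g c(1)])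
        show "continuous_on {u..v} (\<lambda>t. snd c (\<gamma> t))"
          using sub by (intro continuous_on_compose2[OF smooth_atlasD(4)[OF A c(1)]]
              continuous_on_subset[OF cont]) auto
        show "(\<lambda>t. snd c (\<gamma> t)) ` {u..v} \<subseteq> snd c ` fst c" using sub by auto
        show "continuous_on {u..v} D" by (rule continuous_on_subset[OF D(1) sub])
      qed
      then have "(\<lambda>t. sqrt (g c (chart_inv c (snd c (\<gamma> t))) (D t) (D t))) integrable_on {u..v}"
        by (rule integrable_continuous_interval)
      then have "curve_speed A g \<gamma> integrable_on {u..v}"
      proof (rule integrable_spike_finite[of "{a, b}", rotated 2])
        fix t assume t: "t \<in> {u..v} - {a, b}"
        then have "t \<in> {a<..<b}" "\<gamma> t \<in> fst c" using sub by (auto simp: less_le)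
        then show "curve_speed A g \<gamma> t = sqrt (g c (chart_inv c (snd c (\<gamma> t))) (D t) (D t))"
          using D(2) smooth_atlasD(6)[OF A c(1)] by metis
      qed simp
      then show ?thesis by simp
    qed
    then show ?thesis using d(1) by blast
  qed
  then show ?thesis using integrable_on_little_subintervals[of a b "curve_speed A g \<gamma>"] by simp
qed

text \<open>
The pairs of consecutive elements of \<open>F\<close>; they index the smooth pieces of a curve with break points \<open>F\<close>.
\<close>

definition gaps :: "real set \<Rightarrow> (real \<times> real) set" where
  "gaps F = {(a, b). a \<in> F \<and> b \<in> F \<and> a < b \<and> {a<..<b} \<inter> F = {}}"

lemma gaps_cover:
  assumes "finite F" "{0, 1} \<subseteq> F" "F \<subseteq> {0..1}"
  shows "finite (gaps F)" "(\<Union>(a,b)\<in>gaps F. {a..b}) = {0..1}"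
proof -
  show "finite (gaps F)"
    by (rule finite_subset[of _ "F \<times> F"]) (use assms in \<open>auto simp: gaps_def\<close>)
  have "\<exists>a b. (a, b) \<in> gaps F \<and> t \<in> {a..b}" if t: "t \<in> {0..1}" for t
  proof (cases "t = 1")
    case True
    have "finite (F - {1})" "F - {1} \<noteq> {}" using assms by auto
    then obtain a where a: "a \<in> F - {1}" "\<And>f. f \<in> F - {1} \<Longrightarrow> f \<le> a"
      by (metis Max_in Max_ge)
    have "a < 1" using a(1) assms(3) by (auto simp: less_le)
    moreover have "{a<..<1} \<inter> F = {}"
    proof -
      have False if "a < f" "f < 1" "f \<in> F" for f using a(2)[of f] that by simp
      then show ?thesis by auto
    qed
    ultimately show ?thesis using True a(1) assms(2) unfolding gaps_def
      by (intro exI[of _ a] exI[of _ 1]) simp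
  next
    case False
    have f1: "finite {f\<in>F. f \<le> t}" "{f\<in>F. f \<le> t} \<noteq> {}" using assms t by auto
    have f2: "finite {f\<in>F. t < f}" "{f\<in>F. t < f} \<noteq> {}" using assms t False by auto
    obtain a where a: "a \<in> F" "a \<le> t" "\<And>f. f \<in> F \<Longrightarrow> f \<le> t \<Longrightarrow> f \<le> a"
      using Max_in[OF f1] Max_ge[OF f1(1)] by blast
    obtain b where b: "b \<in> F" "t < b" "\<And>f. f \<in> F \<Longrightarrow> t < f \<Longrightarrow> b \<le> f"
      using Min_in[OF f2] Min_le[OF f2(1)] by blast
    have "{a<..<b} \<inter> F = {}"
    proof -
      have False if "a < f" "f < b" "f \<in> F" for f using a(3)[of f] b(3)[of f] that by linarith
      then show ?thesis by auto
    qed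
    then show ?thesis using a(1,2) b(1,2) unfolding gaps_def
      by (intro exI[of _ a] exI[of _ b]) simp
  qed
  moreover have "{a..b} \<subseteq> {0..1}" if "(a, b) \<in> gaps F" for a b
    using that assms(3) unfolding gaps_def by auto
  ultimately show "(\<Union>(a,b)\<in>gaps F. {a..b}) = {0..1}" by fast
qed

lemma gaps_eq:
  assumes "(a, b) \<in> gaps F" "(a', b') \<in> gaps F" "t \<in> {a..b}" "t \<in> {a'..b'}" "t \<notin> F"
  shows "a = a'" "b = b'"
proof -
  have o: "a < t" "t < b" "a' < t" "t < b'" using assms unfolding gaps_def
    by (auto simp: less_le)
  have no: "x \<notin> F" if "(c, d) \<in> gaps F" "c < x" "x < d" for c d x
    using that unfolding gaps_def by auto
  have F: "a \<in> F" "b \<in> F" "a' \<in> F" "b' \<in> F" using assms unfolding gaps_def by auto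
  show "a = a'" using no[OF assms(1), of a'] no[OF assms(2), of a] o F by fastforce
  show "b = b'" using no[OF assms(1), of b'] no[OF assms(2), of b] o F by fastforce
qed

lemma piecewise_C1_curve_gaps:
  assumes "piecewise_C1_curve A \<gamma>"
  obtains F where "finite F" "{0, 1} \<subseteq> F" "F \<subseteq> {0..1}"
    "\<And>a b. (a, b) \<in> gaps F \<Longrightarrow> C1_curve_on A a b \<gamma>"
proof -
  obtain F where F: "finite F" "{0, 1} \<subseteq> F" "F \<subseteq> {0..1}"
    "\<forall>a\<in>F. \<forall>b\<in>F. a < b \<and> {a<..<b} \<inter> F = {} \<longrightarrow> C1_curve_on A a b \<gamma>"
    using assms unfolding piecewise_C1_curve_def by blast
  show ?thesis by (rule that[OF F(1-3)]) (use F(4) in \<open>simp add: gaps_def\<close>)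
qed

lemma piecewise_C1_curve_continuous:
  assumes "piecewise_C1_curve A \<gamma>"
  shows "continuous_on {0..1} \<gamma>"
proof -
  obtain F where F: "finite F" "{0, 1} \<subseteq> F" "F \<subseteq> {0..1}"
    "\<And>a b. (a, b) \<in> gaps F \<Longrightarrow> C1_curve_on A a b \<gamma>"
    using piecewise_C1_curve_gaps[OF assms] by metis
  have "continuous_on (\<Union>p\<in>gaps F. {fst p..snd p}) \<gamma>"
    by (rule continuous_on_closed_Union) (use F(4) gaps_cover[OF F(1-3)] in \<open>auto simp: C1_curve_on_def\<close>)
  then show ?thesis using gaps_cover(2)[OF F(1-3)] by (simp add: case_prod_beta')
qed

text \<open>
Integrability on the whole parameter interval matters: without it the length would be the default
value \<open>0\<close>, and curves could not bound the distance from below.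
\<close>

lemma curve_speed_integrable:
  fixes \<gamma> :: "real \<Rightarrow> 'a::topological_space" and A :: "('a, 'n::finite) chart set"
  assumes A: "smooth_atlas A" and g: "smooth_metric_tensor A g" and \<gamma>: "piecewise_C1_curve A \<gamma>"
  shows "curve_speed A g \<gamma> integrable_on {0..1}"
proof -
  obtain F where F: "finite F" "{0, 1} \<subseteq> F" "F \<subseteq> {0..1}"
    "\<And>a b. (a, b) \<in> gaps F \<Longrightarrow> C1_curve_on A a b \<gamma>"
    using piecewise_C1_curve_gaps[OF \<gamma>] by metis
  let ?I = "\<lambda>(a::real, b). {a..b}"
  have "(curve_speed A g \<gamma> has_integral (\<Sum>S\<in>?I ` gaps F. integral S (curve_speed A g \<gamma>)))
      (\<Union> (?I ` gaps F))"
  proof (rule has_integral_Union)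
    show "finite (?I ` gaps F)" using gaps_cover(1)[OF F(1-3)] by simp
    show "(curve_speed A g \<gamma> has_integral integral S (curve_speed A g \<gamma>)) S" if S: "S \<in> ?I ` gaps F" for S
    proof -
      obtain p where p: "p \<in> gaps F" "S = ?I p" using S by blast
      obtain a b where "p = (a, b)" by fastforce
      with p have "(a, b) \<in> gaps F" "S = {a..b}" by auto
      then show ?thesis using integrable_integral[OF curve_speed_integrable_C1[OF A g F(4)]] by simp
    qed
    show "pairwise (\<lambda>S S'. negligible (S \<inter> S')) (?I ` gaps F)"
    proof (rule pairwiseI)
      fix S S' assume *: "S \<in> ?I ` gaps F" "S' \<in> ?I ` gaps F" "S \<noteq> S'"
      obtain a b where ab: "(a, b) \<in> gaps F" "S = {a..b}" using *(1) by auto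
      obtain a' b' where ab': "(a', b') \<in> gaps F" "S' = {a'..b'}" using *(2) by auto
      have "S \<inter> S' \<subseteq> F"
      proof
        fix t assume t: "t \<in> S \<inter> S'"
        show "t \<in> F"
        proof (rule ccontr)
          assume "t \<notin> F"
          then have "a = a'" "b = b'" using gaps_eq[OF ab(1) ab'(1), of t] t ab(2) ab'(2) by simp_all
          then show False using *(3) ab(2) ab'(2) by simp
        qed
      qed
      then show "negligible (S \<inter> S')"
        using F(1) finite_subset negligible_finite by blast
    qed
  qed
  then show ?thesis unfolding gaps_cover(2)[OF F(1-3)] by (rule has_integral_integrable)
qed


section \<open>Charts are locally bi-Lipschitz\<close>

text \<open>
In coordinates the velocity is at most \<open>1/m\<close> times the speed, and the displacement is the integral
of the velocity; the finitely many break points do not affect the integral.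
\<close>

lemma curve_length_ge_chart_displacement:
  fixes \<gamma> :: "real \<Rightarrow> 'a::topological_space" and A :: "('a, 'n::finite) chart set"
  assumes A: "smooth_atlas A" and g: "smooth_metric_tensor A g" and \<gamma>: "piecewise_C1_curve A \<gamma>"
    and c: "c \<in> A" and T: "0 \<le> T" "T \<le> 1" and m: "0 < m"
    and sub: "\<And>t. t \<in> {0..T} \<Longrightarrow> \<gamma> t \<in> fst c"
    and below: "\<And>t v. t \<in> {0..T} \<Longrightarrow> m * norm v \<le> sqrt (g c (\<gamma> t) v v)"
  shows "m * norm (snd c (\<gamma> T) - snd c (\<gamma> 0)) \<le> curve_length A g \<gamma>"
proof -
  obtain F where F: "finite F" "{0, 1} \<subseteq> F" "F \<subseteq> {0..1}"
    "\<And>a b. (a, b) \<in> gaps F \<Longrightarrow> C1_curve_on A a b \<gamma>"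
    using piecewise_C1_curve_gaps[OF \<gamma>] by metis
  have ex: "\<exists>D. ((snd c \<circ> \<gamma>) has_vector_derivative D) (at t) \<and> m * norm D \<le> curve_speed A g \<gamma> t"
    if t: "t \<in> {0..T} - F" for t
  proof -
    have "t \<in> (\<Union>(a,b)\<in>gaps F. {a..b})" using t T unfolding gaps_cover(2)[OF F(1-3)] by auto
    then obtain a b where ab: "(a, b) \<in> gaps F" "t \<in> {a..b}" by blast
    then have ab': "t \<in> {a<..<b}" using t unfolding gaps_def by (auto simp: less_le)
    have tc: "\<gamma> t \<in> fst c" using sub t by blast
    show ?thesis
      using C1_curve_chart_derivative[OF A g F(4)[OF ab(1)] c] ab' tc below t by fastforce
  qed
  obtain D where D: "\<And>t. t \<in> {0..T} - F \<Longrightarrow> ((snd c \<circ> \<gamma>) has_vector_derivative D t) (at t)"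
    "\<And>t. t \<in> {0..T} - F \<Longrightarrow> m * norm (D t) \<le> curve_speed A g \<gamma> t"
    using ex by metis
  define D' where "D' = (\<lambda>t. if t \<in> F then 0 else D t)"
  have int1: "curve_speed A g \<gamma> integrable_on {0..1}" by (rule curve_speed_integrable[OF A g \<gamma>])
  then have int: "curve_speed A g \<gamma> integrable_on {0..T}"
    by (rule integrable_on_subinterval) (use T in auto)
  have "continuous_on {0..T} \<gamma>"
    using piecewise_C1_curve_continuous[OF \<gamma>] by (rule continuous_on_subset) (use T in auto)
  then have "continuous_on {0..T} (snd c \<circ> \<gamma>)"
    using sub by (intro continuous_on_compose continuous_on_subset[OF smooth_atlasD(4)[OF A c]]) auto
  then have "(D' has_integral ((snd c \<circ> \<gamma>) T - (snd c \<circ> \<gamma>) 0)) {0..T}"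
    by (intro fundamental_theorem_of_calculus_interior_strong[OF F(1) T(1)])
      (use D(1) in \<open>auto simp: D'_def comp_def\<close>)
  moreover have "norm (D' t) \<le> curve_speed A g \<gamma> t / m" if "t \<in> {0..T}" for t
    using D(2)[of t] that m curve_speed_nonneg[OF A g, of \<gamma> t]
    by (auto simp: D'_def field_simps)
  moreover have "(\<lambda>t. curve_speed A g \<gamma> t / m) integrable_on {0..T}"
    using int by (rule integrable_on_divide)
  ultimately have "norm ((snd c \<circ> \<gamma>) T - (snd c \<circ> \<gamma>) 0) \<le> integral {0..T} (\<lambda>t. curve_speed A g \<gamma> t / m)"
    by (metis integral_norm_bound_integral has_integral_integrable integral_unique)
  also have "\<dots> = integral {0..T} (curve_speed A g \<gamma>) / m" by simp
  also have "\<dots> \<le> curve_length A g \<gamma> / m"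
    unfolding curve_length_def using T m int int1 curve_speed_nonneg[OF A g]
    by (intro divide_right_mono integral_subset_le) auto
  finally show ?thesis using m by (simp add: field_simps)
qed

text \<open>
A curve may leave the chart, but then it has first to travel far inside it. If its length were too
small, then up to its first exit from the ball of radius \<open>3R\<close> it would stay in a smaller closed ball,
whose image is compact and hence closed; so it never exits, and the displacement estimate applies to
all of it.
\<close>

lemma curve_length_ge_within_chart_ball:
  fixes \<gamma> :: "real \<Rightarrow> 'a::t2_space" and A :: "('a, 'n::finite) chart set"
  assumes A: "smooth_atlas A" and g: "smooth_metric_tensor A g" and \<gamma>: "piecewise_C1_curve A \<gamma>"
    and c: "c \<in> A" and R: "cball q (3 * R) \<subseteq> snd c ` fst c" and m: "0 < m"
    and below: "\<And>u v. u \<in> cball q (3 * R) \<Longrightarrow> m * norm v \<le> sqrt (g c (chart_inv c u) v v)"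
    and uv: "u \<in> ball q R" "v \<in> ball q R" "\<gamma> 0 = chart_inv c u" "\<gamma> 1 = chart_inv c v"
  shows "m * norm (v - u) \<le> curve_length A g \<gamma>"
proof (rule ccontr)
  assume neg: "\<not> ?thesis"
  then have short: "curve_length A g \<gamma> / m < norm (v - u)" using m by (simp add: field_simps)
  have Rpos: "0 < R" using uv(1) by (metis mem_ball zero_le_dist le_less_trans)
  have "norm (v - u) \<le> dist q u + dist q v" by (metis dist_norm dist_triangle3 dist_commute add.commute)
  then have "norm (v - u) < 2 * R" using uv(1,2) by simp
  \<comment> \<open>The farthest that a curve of this length can get from \<open>q\<close> in coordinates.\<close>
  define \<rho> where "\<rho> = R + curve_length A g \<gamma> / m"
  have \<rho>: "\<rho> < 3 * R" using short \<open>norm (v - u) < 2 * R\<close> unfolding \<rho>_def by simp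
  define O' where "O' = {x \<in> fst c. snd c x \<in> ball q (3 * R)}"
  define K where "K = chart_inv c ` cball q \<rho>"
  have sub: "ball q R \<subseteq> snd c ` fst c" "cball q \<rho> \<subseteq> snd c ` fst c"
    using R \<rho> Rpos by (auto simp: subset_iff dist_norm)
  have "openin (top_of_set (fst c)) (fst c \<inter> snd c -` ball q (3 * R))"
    by (rule continuous_openin_preimage_gen[OF smooth_atlasD(4)[OF A c] open_ball])
  then have "open O'"
    using smooth_atlasD(2)[OF A c] openin_open_trans unfolding O'_def vimage_def Int_def by force
  have "compact K"
    unfolding K_def by (intro compact_continuous_image continuous_on_subset[OF smooth_atlasD(5)[OF A c] sub(2)]) simp
  then have "closed K" by (rule compact_imp_closed)
  have KO: "K \<subseteq> O'"
    unfolding K_def O'_def using sub(2) \<rho> smooth_atlasD(7,8)[OF A c] by (auto simp: subset_iff)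
  have c0: "snd c (\<gamma> 0) = u" "snd c (\<gamma> 1) = v" using uv sub(1) smooth_atlasD(7)[OF A c] by auto
  have bound: "m * norm (snd c (\<gamma> t) - u) \<le> curve_length A g \<gamma>"
    if t: "0 \<le> t" "t \<le> 1" "\<And>s. s \<in> {0..t} \<Longrightarrow> \<gamma> s \<in> O'" for t
  proof -
    have "m * norm w \<le> sqrt (g c (\<gamma> s) w w)" if "s \<in> {0..t}" for s w
    proof -
      have "\<gamma> s \<in> fst c" "snd c (\<gamma> s) \<in> cball q (3 * R)" using t(3)[OF that] unfolding O'_def by auto
      then show ?thesis using below[of "snd c (\<gamma> s)" w] smooth_atlasD(6)[OF A c] by simp
    qed
    then show ?thesis
      using curve_length_ge_chart_displacement[OF A g \<gamma> c t(1,2) m] t(3)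
      unfolding c0 O'_def by simp
  qed
  have inK: "\<gamma> t \<in> K" if t: "0 \<le> t" "t \<le> 1" "\<And>s. s \<in> {0..t} \<Longrightarrow> \<gamma> s \<in> O'" for t
  proof -
    have "norm (snd c (\<gamma> t) - u) \<le> curve_length A g \<gamma> / m"
      using bound[OF t] m by (simp add: field_simps)
    moreover have "dist q (snd c (\<gamma> t)) \<le> dist q u + norm (snd c (\<gamma> t) - u)"
      using dist_triangle[of q "snd c (\<gamma> t)" u] by (simp add: dist_norm norm_minus_commute)
    ultimately have "snd c (\<gamma> t) \<in> cball q \<rho>" using uv(1) unfolding \<rho>_def by simp
    moreover have "\<gamma> t \<in> fst c" using t(3)[of t] t(1) unfolding O'_def by auto
    ultimately show ?thesis unfolding K_def using smooth_atlasD(6)[OF A c] by (metis imageI)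
  qed
  have cont: "continuous_on {0..1} \<gamma>" by (rule piecewise_C1_curve_continuous[OF \<gamma>])
  have all: "\<gamma> t \<in> O'" if "t \<in> {0..1}" for t
  proof (rule ccontr)
    assume "\<gamma> t \<notin> O'"
    define Z where "Z = {0..1} \<inter> \<gamma> -` (- O')"
    have "closed Z" unfolding Z_def
      using continuous_closed_preimage[OF cont] \<open>open O'\<close> by blast
    moreover have "Z \<noteq> {}" "bdd_below Z" using \<open>\<gamma> t \<notin> O'\<close> that unfolding Z_def by auto
    ultimately have inf: "Inf Z \<in> Z" by (rule closed_contains_Inf[rotated 2])
    define T where "T = Inf Z"
    have T: "0 \<le> T" "T \<le> 1" "\<gamma> T \<notin> O'" using inf unfolding T_def Z_def by auto
    have before: "\<gamma> s \<in> O'" if "0 \<le> s" "s < T" for s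
    proof (rule ccontr)
      assume "\<gamma> s \<notin> O'"
      then have "s \<in> Z" using that T unfolding Z_def by auto
      then have "T \<le> s" unfolding T_def using \<open>bdd_below Z\<close> by (rule cInf_lower)
      then show False using that by simp
    qed
    have "\<gamma> 0 \<in> O'" unfolding O'_def using uv(1,3) sub(1) c0 Rpos smooth_atlasD(8)[OF A c] by auto
    then have "T > 0" using T by (metis less_le)
    have "\<gamma> ` {0..<T} \<subseteq> K" using before inK T by auto
    moreover have "continuous_on (closure {0..<T}) \<gamma>"
      using \<open>T > 0\<close> T by (auto intro: continuous_on_subset[OF cont])
    ultimately have "\<gamma> ` closure {0..<T} \<subseteq> K" using image_closure_subset \<open>closed K\<close> by blast
    then have "\<gamma> T \<in> K" using \<open>T > 0\<close> by auto
    then show False using KO T by blast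
  qed
  then have "m * norm (v - u) \<le> curve_length A g \<gamma>" using bound[of 1] c0 by auto
  then show False using neg by blast
qed

text \<open>
Straight segments in a chart are admissible curves. They show that the infimum defining the distance
ranges over a nonempty set, and they bound the distance from above.
\<close>

lemma coordinate_segment:
  fixes A :: "('a::topological_space, 'n::finite) chart set"
  assumes A: "smooth_atlas A" and g: "smooth_metric_tensor A g" and c: "c \<in> A"
    and seg: "\<And>t. t \<in> {0..1} \<Longrightarrow> u + t *\<^sub>R w \<in> snd c ` fst c"
    and above: "\<And>t v. t \<in> {0..1} \<Longrightarrow> sqrt (g c (chart_inv c (u + t *\<^sub>R w)) v v) \<le> M * norm v"
  shows "piecewise_C1_curve A (\<lambda>t. chart_inv c (u + t *\<^sub>R w))"
    and "curve_length A g (\<lambda>t. chart_inv c (u + t *\<^sub>R w)) \<le> M * norm w"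
proof -
  define \<gamma> where "\<gamma> = (\<lambda>t. chart_inv c (u + t *\<^sub>R w))"
  have cont: "continuous_on {0..1} \<gamma>" unfolding \<gamma>_def
    by (intro continuous_on_compose2[OF smooth_atlasD(5)[OF A c]] continuous_intros) (use seg in auto)
  have line: "((\<lambda>t. u + t *\<^sub>R w) has_vector_derivative w) (at t within X)" for t X
    by (auto intro!: derivative_eq_intros)
  have "C1_curve_on A 0 1 \<gamma>"
    unfolding C1_curve_on_def
  proof (intro conjI ballI cont)
    fix c' assume c': "c' \<in> A"
    let ?T = "snd c' \<circ> chart_inv c"
    let ?X = "snd c ` (fst c \<inter> fst c')"
    let ?D = "\<lambda>t. frechet_derivative ?T (at (u + t *\<^sub>R w)) w"
    have sm: "smooth_on ?X ?T" by (rule smooth_atlasD(9)[OF A c c'])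
    have X: "u + t *\<^sub>R w \<in> ?X" if "t \<in> {0..1}" "\<gamma> t \<in> fst c'" for t
      using that(2) smooth_atlasD(7,8)[OF A c seg[OF that(1)]] unfolding \<gamma>_def
      by (metis IntI imageI)
    show "\<exists>D. continuous_on {t\<in>{0..1}. \<gamma> t \<in> fst c'} D \<and>
        (\<forall>t\<in>{0..1}. \<gamma> t \<in> fst c' \<longrightarrow>
           ((snd c' \<circ> \<gamma>) has_vector_derivative D t) (at t within {0..1}))"
    proof (intro exI[of _ ?D] conjI ballI impI)
      show "continuous_on {t\<in>{0..1}. \<gamma> t \<in> fst c'} ?D"
        by (intro continuous_on_compose2[OF smooth_onD(3)[OF sm]] continuous_intros) (use X in auto)
      fix t assume "t \<in> {0..1::real}" "\<gamma> t \<in> fst c'"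
      then have "?T differentiable (at (u + t *\<^sub>R w))" using smooth_onD(2)[OF sm] X by blast
      then have "(?T has_derivative frechet_derivative ?T (at (u + t *\<^sub>R w))) (at (u + t *\<^sub>R w))"
        by (simp add: frechet_derivative_works)
      then have "((?T \<circ> (\<lambda>t. u + t *\<^sub>R w)) has_vector_derivative ?D t) (at t within {0..1})"
        by (rule vector_derivative_diff_chain_within[OF line has_derivative_at_withinI])
      moreover have "?T \<circ> (\<lambda>t. u + t *\<^sub>R w) = snd c' \<circ> \<gamma>" unfolding \<gamma>_def by auto
      ultimately show "((snd c' \<circ> \<gamma>) has_vector_derivative ?D t) (at t within {0..1})" by simp
    qed
  qed
  then have C1: "C1_curve_on A 0 1 \<gamma>" .
  show pw: "piecewise_C1_curve A (\<lambda>t. chart_inv c (u + t *\<^sub>R w))"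
    unfolding piecewise_C1_curve_def \<gamma>_def[symmetric]
    by (rule exI[of _ "{0, 1}"]) (use C1 in auto)
  have speed: "curve_speed A g \<gamma> t \<le> M * norm w" if t: "t \<in> {0<..<1}" for t
  proof -
    have tt: "t \<in> {0..1}" "at t within {0..1} = at t" using t by (auto simp: at_within_Icc_at)
    have "open (snd c ` fst c)" by (rule smooth_atlasD(3)[OF A c])
    moreover have "isCont (\<lambda>s. u + s *\<^sub>R w) t" by (intro continuous_intros)
    ultimately obtain e where e: "e > 0" "\<And>s. dist s t < e \<Longrightarrow> u + s *\<^sub>R w \<in> snd c ` fst c"
      using seg[OF tt(1)] unfolding continuous_at_open by (metis open_dist)
    have "((snd c \<circ> \<gamma>) has_vector_derivative w) (at t)"
      by (rule has_vector_derivative_transform_within[OF line e(1)])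
        (auto simp: \<gamma>_def smooth_atlasD(7)[OF A c] dest!: e(2))
    moreover have "\<gamma> t \<in> fst c" unfolding \<gamma>_def by (rule smooth_atlasD(8)[OF A c seg[OF tt(1)]])
    moreover have "isCont \<gamma> t"
      using cont tt unfolding continuous_on_eq_continuous_within by metis
    ultimately have "curve_speed A g \<gamma> t = sqrt (g c (\<gamma> t) w w)"
      using curve_speed_in_chart[OF A g c] by blast
    then show ?thesis using above[OF tt(1)] unfolding \<gamma>_def by simp
  qed
  have int: "curve_speed A g \<gamma> integrable_on {0..1}"
    using curve_speed_integrable[OF A g] pw unfolding \<gamma>_def by blast
  have "((\<lambda>t. min (curve_speed A g \<gamma> t) (M * norm w)) has_integral
      integral {0..1} (curve_speed A g \<gamma>)) {0..1}"
    by (rule has_integral_spike_finite[of "{0,1}", OF _ _ integrable_integral[OF int]])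
      (use speed in \<open>auto simp: min_def less_le\<close>)
  then have "integral {0..1} (curve_speed A g \<gamma>) \<le> M * norm w"
    by (rule has_integral_le[OF _ has_integral_const_real[of "M * norm w" 0 1, simplified]]) simp
  then show "curve_length A g (\<lambda>t. chart_inv c (u + t *\<^sub>R w)) \<le> M * norm w"
    unfolding curve_length_def \<gamma>_def by simp
qed

lemma bilipschitz_chart:
  fixes A :: "('a::{metric_space, second_countable_topology}, 'n::finite) chart set" and p :: 'a
  assumes mf: "riemannian_manifold A g" and dist: "\<And>x y. dist x y = riemannian_dist A g x y"
  obtains \<psi> :: "real ^ 'n \<Rightarrow> 'a" and R L r0 where "0 < R" "0 < L" "0 < r0" "\<psi> 0 = p"
    "\<And>v w. v \<in> ball 0 R \<Longrightarrow> w \<in> ball 0 R \<Longrightarrow> dist v w \<le> L * dist (\<psi> v) (\<psi> w)"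
    "\<And>v w. v \<in> ball 0 R \<Longrightarrow> w \<in> ball 0 R \<Longrightarrow> dist (\<psi> v) (\<psi> w) \<le> L * dist v w"
    "ball p r0 \<subseteq> \<psi> ` ball 0 R"
proof -
  have A: "smooth_atlas A" and g: "smooth_metric_tensor A g"
    using mf unfolding riemannian_manifold_def by blast+
  obtain c where c: "c \<in> A" "p \<in> fst c" using smooth_atlasD(1)[OF A] by blast
  define q where "q = snd c p"
  have "q \<in> snd c ` fst c" using c unfolding q_def by blast
  then obtain R' where R': "R' > 0" "cball q R' \<subseteq> snd c ` fst c"
    using smooth_atlasD(3)[OF A c(1)] open_contains_cball by blast
  define R where "R = R' / 3"
  have R: "R > 0" "cball q (3 * R) \<subseteq> snd c ` fst c" using R' unfolding R_def by auto
  obtain m M where mM: "0 < m" "0 < M"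
    "\<And>u v. u \<in> cball q (3 * R) \<Longrightarrow> m * norm v \<le> sqrt (g c (chart_inv c u) v v)"
    "\<And>u v. u \<in> cball q (3 * R) \<Longrightarrow> sqrt (g c (chart_inv c u) v v) \<le> M * norm v"
    using metric_norm_comparable[OF g c(1) compact_cball R(2)] by metis
  define \<psi> where "\<psi> = (\<lambda>v. chart_inv c (q + v))"
  define L where "L = max M (1 / m)"
  have L: "L > 0" "M \<le> L" "1 / m \<le> L" using mM unfolding L_def by auto
  have both: "m * norm (w - v) \<le> dist (\<psi> v) (\<psi> w)" "dist (\<psi> v) (\<psi> w) \<le> M * norm (w - v)"
    if vw: "v \<in> ball 0 R" "w \<in> ball 0 R" for v w
  proof -
    let ?S = "{curve_length A g \<gamma> |\<gamma>. piecewise_C1_curve A \<gamma> \<and> \<gamma> 0 = \<psi> v \<and> \<gamma> 1 = \<psi> w}"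
    have d: "dist (\<psi> v) (\<psi> w) = Inf ?S" using dist unfolding riemannian_dist_def .
    have inb: "(q + v) + t *\<^sub>R (w - v) \<in> cball q (3 * R)" if "t \<in> {0..1}" for t
    proof -
      have "(1 - t) *\<^sub>R v + t *\<^sub>R w \<in> ball 0 R"
        using that vw by (intro convexD_alt[OF convex_ball]) auto
      then have "norm (v + t *\<^sub>R (w - v)) < R" by (simp add: algebra_simps)
      moreover have "dist q ((q + v) + t *\<^sub>R (w - v)) = norm (v + t *\<^sub>R (w - v))"
        unfolding dist_commute[of q] by (simp add: dist_norm add.assoc)
      ultimately show ?thesis using R(1) by simp
    qed
    have seg: "piecewise_C1_curve A (\<lambda>t. chart_inv c ((q + v) + t *\<^sub>R (w - v)))"
      "curve_length A g (\<lambda>t. chart_inv c ((q + v) + t *\<^sub>R (w - v))) \<le> M * norm (w - v)"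
      using coordinate_segment[OF A g c(1), of "q + v" "w - v" M] inb R(2) mM(4) by blast+
    have "bdd_below ?S" by (rule bdd_belowI[of _ 0]) (use curve_length_nonneg[OF A g] in auto)
    moreover have mem: "curve_length A g (\<lambda>t. chart_inv c ((q + v) + t *\<^sub>R (w - v))) \<in> ?S"
      using seg(1) unfolding \<psi>_def
      by (intro CollectI exI[of _ "\<lambda>t. chart_inv c ((q + v) + t *\<^sub>R (w - v))"] conjI refl) auto
    ultimately have "Inf ?S \<le> curve_length A g (\<lambda>t. chart_inv c ((q + v) + t *\<^sub>R (w - v)))"
      by (intro cInf_lower)
    then show "dist (\<psi> v) (\<psi> w) \<le> M * norm (w - v)" using seg(2) d by linarith
    have "m * norm ((q + w) - (q + v)) \<le> curve_length A g \<gamma>"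
      if "piecewise_C1_curve A \<gamma>" "\<gamma> 0 = \<psi> v" "\<gamma> 1 = \<psi> w" for \<gamma>
      using that vw by (intro curve_length_ge_within_chart_ball[OF A g _ c(1) R(2) mM(1) mM(3)])
        (auto simp: \<psi>_def dist_norm)
    then have "m * norm (w - v) \<le> Inf ?S"
      using mem by (intro cInf_greatest) auto
    then show "m * norm (w - v) \<le> dist (\<psi> v) (\<psi> w)" using d by simp
  qed
  define O' where "O' = {x \<in> fst c. snd c x \<in> ball q R}"
  have "openin (top_of_set (fst c)) (fst c \<inter> snd c -` ball q R)"
    by (rule continuous_openin_preimage_gen[OF smooth_atlasD(4)[OF A c(1)] open_ball])
  then have "open O'"
    using smooth_atlasD(2)[OF A c(1)] openin_open_trans unfolding O'_def vimage_def Int_def by force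
  moreover have "p \<in> O'" unfolding O'_def using c R unfolding q_def by simp
  ultimately obtain r0 where r0: "r0 > 0" "ball p r0 \<subseteq> O'" using open_contains_ball by blast
  have "O' \<subseteq> \<psi> ` ball 0 R"
  proof
    fix x assume x: "x \<in> O'"
    then have "x = \<psi> (snd c x - q)" "snd c x - q \<in> ball 0 R"
      unfolding \<psi>_def O'_def using smooth_atlasD(6)[OF A c(1)]
      by (auto simp: dist_norm norm_minus_commute)
    then show "x \<in> \<psi> ` ball 0 R" by blast
  qed
  show ?thesis
  proof (rule that[OF R(1) L(1) r0(1)])
    show "\<psi> 0 = p" unfolding \<psi>_def q_def using smooth_atlasD(6)[OF A c] by simp
    show "ball p r0 \<subseteq> \<psi> ` ball 0 R" using r0(2) \<open>O' \<subseteq> \<psi> ` ball 0 R\<close> by blast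
    fix v w :: "real ^ 'n" assume vw: "v \<in> ball 0 R" "w \<in> ball 0 R"
    have "norm (w - v) \<le> (1 / m) * dist (\<psi> v) (\<psi> w)"
      using both(1)[OF vw] mM(1) by (simp add: field_simps)
    also have "\<dots> \<le> L * dist (\<psi> v) (\<psi> w)" using L by (intro mult_right_mono) auto
    finally show "dist v w \<le> L * dist (\<psi> v) (\<psi> w)" by (simp add: dist_norm norm_minus_commute)
    have "M * norm (w - v) \<le> L * norm (w - v)" using L by (intro mult_right_mono) auto
    then show "dist (\<psi> v) (\<psi> w) \<le> L * dist v w"
      using both(2)[OF vw] by (simp add: dist_norm norm_minus_commute)
  qed
qed


section \<open>Capacity of geodesic spheres\<close>

text \<open>
The part of the tube of width \<open>\<eta>\<close> about a ray that lies in the unit ball is covered by \<open>O(1/\<eta>)\<close> balls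
of radius \<open>2\<eta>\<close>, which leaves one factor of \<open>\<eta>\<close> fewer than the dimension. It stands in for the area of
a spherical cap of radius \<open>\<eta>\<close>.
\<close>

lemma emeasure_tube_le:
  fixes z :: "'e::euclidean_space"
  assumes A: "A \<in> sets lborel" "A \<subseteq> ball 0 1" and \<eta>: "0 < \<eta>"
    and tube: "\<And>u. u \<in> A \<Longrightarrow> \<exists>l\<ge>0. norm (u - l *\<^sub>R z) < \<eta>"
  shows "emeasure lborel A
    \<le> ennreal (3 * 2 ^ DIM('e) * unit_ball_vol (real DIM('e)) * \<eta> powr (real DIM('e) - 1))"
proof -
  let ?n = "DIM('e)" and ?\<omega> = "unit_ball_vol (real DIM('e))"
  have \<omega>: "0 \<le> ?\<omega>" by simp
  show ?thesis
  proof (cases "\<eta> \<le> 1")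
    case False
    have "emeasure lborel A \<le> emeasure lborel (ball (0::'e) 1)" using A by (intro emeasure_mono) auto
    also have "\<dots> = ennreal (1 * 1 * ?\<omega> * 1)" by (simp add: emeasure_ball)
    also have "\<dots> \<le> ennreal (3 * 2 ^ ?n * ?\<omega> * \<eta> powr (real ?n - 1))"
    proof (intro ennreal_leI mult_mono)
      show "1 \<le> \<eta> powr (real ?n - 1)"
        using False DIM_positive[where 'a='e] by (intro ge_one_powr_ge_zero) auto
    qed auto
    finally show ?thesis .
  next
    case True
    define K where "K = nat \<lfloor>2 / \<eta>\<rfloor>"
    let ?c = "\<lambda>k::nat. (real k * \<eta>) *\<^sub>R sgn z"
    have "A \<subseteq> (\<Union>k\<in>{..K}. ball (?c k) (2 * \<eta>))"
    proof
      fix u assume u: "u \<in> A"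
      then obtain l where l: "0 \<le> l" "norm (u - l *\<^sub>R z) < \<eta>" using tube by blast
      define l' where "l' = l * norm z"
      have l': "0 \<le> l'" "l *\<^sub>R z = l' *\<^sub>R sgn z"
        using l(1) unfolding l'_def sgn_div_norm by (simp, cases "z = 0", simp, simp)
      have "norm (l *\<^sub>R z) \<le> norm u + norm (u - l *\<^sub>R z)"
        using norm_triangle_sub[of "l *\<^sub>R z" u] by (simp add: norm_minus_commute)
      also have "\<dots> \<le> 2" using u A(2) l(2) True by force
      finally have l2: "l' \<le> 2" using l(1) unfolding l'_def by simp
      \<comment> \<open>Round the position along the ray to a multiple of \<open>\<eta>\<close>.\<close>
      define k where "k = nat \<lfloor>l' / \<eta>\<rfloor>"
      have "k \<le> K" unfolding k_def K_def using l2 \<eta> by (intro nat_mono floor_mono divide_right_mono) auto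
      have k: "real k \<le> l' / \<eta>" "l' / \<eta> < real k + 1"
        using l'(1) \<eta> unfolding k_def by (auto simp: of_nat_nat)
      then have "\<bar>l' - real k * \<eta>\<bar> \<le> \<eta>" using \<eta> by (auto simp: field_simps abs_if)
      moreover have "norm (l *\<^sub>R z - ?c k) = \<bar>l' - real k * \<eta>\<bar> * norm (sgn z)"
        unfolding l'(2) by (simp add: scaleR_left_diff_distrib[symmetric])
      moreover have "norm (sgn z) \<le> 1" by (simp add: norm_sgn)
      ultimately have "norm (l *\<^sub>R z - ?c k) \<le> \<eta> * 1"
        using \<eta> mult_mono[of "\<bar>l' - real k * \<eta>\<bar>" \<eta> "norm (sgn z)" 1] by simp
      then have "norm (u - ?c k) < 2 * \<eta>"
        using norm_triangle_ineq[of "u - l *\<^sub>R z" "l *\<^sub>R z - ?c k"] l(2) by simp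
      then show "u \<in> (\<Union>k\<in>{..K}. ball (?c k) (2 * \<eta>))"
        using \<open>k \<le> K\<close> by (intro UN_I[of k]) (auto simp: dist_norm norm_minus_commute)
    qed
    then have "emeasure lborel A \<le> emeasure lborel (\<Union>k\<in>{..K}. ball (?c k) (2 * \<eta>))"
      by (intro emeasure_mono) auto
    also have "\<dots> \<le> (\<Sum>k\<in>{..K}. emeasure lborel (ball (?c k) (2 * \<eta>)))"
      by (intro emeasure_subadditive_finite) auto
    also have "\<dots> = (\<Sum>k\<in>{..K}. ennreal (?\<omega> * (2 * \<eta>) ^ ?n))" using \<eta> by (simp add: emeasure_ball)
    also have "\<dots> = ennreal (real (K + 1) * (?\<omega> * (2 * \<eta>) ^ ?n))"
      using \<eta> by (subst sum_ennreal) (auto simp: algebra_simps)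
    also have "\<dots> \<le> ennreal (3 / \<eta> * (?\<omega> * (2 * \<eta>) ^ ?n))"
    proof (intro ennreal_leI mult_right_mono)
      have "real K \<le> 2 / \<eta>" unfolding K_def using \<eta> by (simp add: of_nat_nat)
      moreover have "1 \<le> 1 / \<eta>" using \<eta> True by simp
      ultimately show "real (K + 1) \<le> 3 / \<eta>" by (simp add: field_simps)
    qed (use \<eta> in auto)
    also have "3 / \<eta> * (?\<omega> * (2 * \<eta>) ^ ?n) = 3 * 2 ^ ?n * ?\<omega> * \<eta> powr (real ?n - 1)"
      using \<eta> by (simp add: powr_diff powr_realpow power_mult_distrib)
    finally show ?thesis .
  qed
qed

text \<open>
The first time at which the ray through \<open>u\<close> leaves \<open>W\<close>. It exceeds \<open>a\<close> exactly when the compact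
segment \<open>{t u | 0 \<le> t \<le> a}\<close> lies in the open set \<open>W\<close>, which is an open condition on \<open>u\<close>; hence the
exit time is lower semicontinuous, and in particular Borel measurable.
\<close>

lemma first_exit_time:
  fixes W :: "'e::euclidean_space set"
  assumes W: "open W" "bounded W" and \<tau>: "0 < \<tau>" "ball 0 \<tau> \<subseteq> W"
  shows "\<exists>T. T \<in> borel_measurable borel \<and>
    (\<forall>u. u \<noteq> 0 \<longrightarrow> T u *\<^sub>R u \<in> closure W - W \<and> 0 < T u \<and> \<tau> \<le> T u * norm u)"
proof -
  define Z where "Z u = {t. 0 \<le> t \<and> t *\<^sub>R u \<notin> W}" for u
  define T where "T u = (if u = 0 then 0 else Inf (Z u))" for u
  have bdd: "bdd_below (Z u)" for u unfolding Z_def by (rule bdd_belowI[of _ 0]) simp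
  have TZ: "T u \<in> Z u" if "u \<noteq> 0" for u
  proof -
    obtain B where B: "\<And>w. w \<in> W \<Longrightarrow> norm w \<le> B" using W(2) unfolding bounded_iff by blast
    have "0 \<in> W" using \<tau> by auto
    then have "0 \<le> B" using B by force
    then have "(B + 1) / norm u \<in> Z u" using that B[of "((B + 1) / norm u) *\<^sub>R u"] unfolding Z_def by auto
    then have "Z u \<noteq> {}" by blast
    moreover have "closed (Z u)"
    proof -
      have "Z u = {0..} \<inter> (\<lambda>t. t *\<^sub>R u) -` (- W)" unfolding Z_def by auto
      moreover have "closed ({0..} \<inter> (\<lambda>t. t *\<^sub>R u) -` (- W))"
        by (rule continuous_closed_preimage) (use W in \<open>auto intro!: continuous_intros\<close>)
      ultimately show ?thesis by simp
    qed
    ultimately show ?thesis using closed_contains_Inf[OF _ bdd] that unfolding T_def by simp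
  qed
  have before: "t *\<^sub>R u \<in> W" if "u \<noteq> 0" "0 \<le> t" "t < T u" for t u
  proof (rule ccontr)
    assume "t *\<^sub>R u \<notin> W"
    then have "t \<in> Z u" using that unfolding Z_def by simp
    then have "T u \<le> t" unfolding T_def using cInf_lower[OF _ bdd] that(1) by simp
    then show False using that by simp
  qed
  have main: "T u *\<^sub>R u \<in> closure W - W \<and> 0 < T u \<and> \<tau> \<le> T u * norm u" if u: "u \<noteq> 0" for u
  proof -
    have T0: "0 \<le> T u" "T u *\<^sub>R u \<notin> W" using TZ[OF u] unfolding Z_def by auto
    then have "T u *\<^sub>R u \<notin> ball 0 \<tau>" using \<tau> by blast
    then have \<tau>': "\<tau> \<le> T u * norm u" using T0 by simp
    then have pos: "0 < T u" using \<tau>(1) T0(1) by (cases "T u = 0") auto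
    have "(\<lambda>t. t *\<^sub>R u) ` closure {0..<T u} \<subseteq> closure W"
    proof (rule image_closure_subset)
      show "(\<lambda>t. t *\<^sub>R u) ` {0..<T u} \<subseteq> closure W" using before[OF u] closure_subset by fastforce
    qed (auto intro!: continuous_intros)
    moreover have "T u \<in> closure {0..<T u}" using pos by simp
    ultimately have "T u *\<^sub>R u \<in> closure W" by blast
    then show ?thesis using T0 \<tau>' pos by blast
  qed
  have "open {u. a < T u}" for a
  proof (cases "a < 0")
    case True
    have "a < T u" for u using main[of u] True unfolding T_def by (cases "u = 0") auto
    then show ?thesis by simp
  next
    case False
    have "{u. a < T u} = - {0} \<inter> {u. \<forall>t\<in>{0..a}. t *\<^sub>R u \<in> W}"
    proof (intro set_eqI iffI)
      fix u assume "u \<in> {u. a < T u}"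
      then show "u \<in> - {0} \<inter> {u. \<forall>t\<in>{0..a}. t *\<^sub>R u \<in> W}"
        using before[of u] False unfolding T_def by (cases "u = 0") auto
    next
      fix u assume "u \<in> - {0} \<inter> {u. \<forall>t\<in>{0..a}. t *\<^sub>R u \<in> W}"
      then show "u \<in> {u. a < T u}" using main[of u] by fastforce
    qed
    moreover have "open {u. \<forall>t\<in>{0..a}. t *\<^sub>R u \<in> W}"
      unfolding open_dist
    proof clarify
      fix u assume u: "\<forall>t\<in>{0..a}. t *\<^sub>R u \<in> W"
      have "compact ((\<lambda>t. t *\<^sub>R u) ` {0..a})"
        by (intro compact_continuous_image continuous_intros) simp
      moreover have "(\<lambda>t. t *\<^sub>R u) ` {0..a} \<subseteq> W" using u by blast
      ultimately obtain e where e: "e > 0" "(\<Union>x\<in>(\<lambda>t. t *\<^sub>R u) ` {0..a}. ball x e) \<subseteq> W"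
        using compact_subset_open_imp_ball_epsilon_subset[OF _ W(1)] by metis
      have "t *\<^sub>R v \<in> W" if v: "dist v u < e / (a + 1)" and t: "t \<in> {0..a}" for v t
      proof -
        have "dist (t *\<^sub>R u) (t *\<^sub>R v) = t * dist v u"
          using t by (simp add: dist_norm scaleR_diff_right[symmetric] norm_minus_commute)
        also have "\<dots> \<le> (a + 1) * dist v u" using t by (intro mult_right_mono) auto
        also have "\<dots> < e" using v False by (simp add: field_simps)
        finally have "t *\<^sub>R v \<in> ball (t *\<^sub>R u) e" by simp
        then show ?thesis using e(2) t by blast
      qed
      then show "\<exists>e'>0. \<forall>v. dist v u < e' \<longrightarrow> v \<in> {u. \<forall>t\<in>{0..a}. t *\<^sub>R u \<in> W}"
        using e(1) False by (intro exI[of _ "e / (a + 1)"]) auto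
    qed
    ultimately show ?thesis by auto
  qed
  then have "T \<in> borel_measurable borel" by (intro borel_measurableI_greater) auto
  then show ?thesis using main by blast
qed

text \<open>
The exit point of the ray through \<open>u\<close>, taken from the coordinate image \<open>W\<close> of the ball, lies on its
frontier, and the exit time is at least \<open>r/L\<close>. If the exit point is within \<open>t\<close> of \<open>y\<close>, then
dividing by the exit time puts \<open>u\<close> into the tube of width \<open>L\<^sup>2 t / r\<close> about the ray through the
coordinates of \<open>y\<close>. The push-forward of Lebesgue measure thus has growth exponent \<open>n - 1 > s\<close>,
and its potential at points of \<open>B\<^sub>2\<^sub>r(p)\<close> is \<open>O(r\<^sup>-\<^sup>s)\<close>.
\<close>

lemma capacity_frontier_ball_ge:
  fixes \<psi> :: "'e::euclidean_space \<Rightarrow> 'a::{metric_space, second_countable_topology}"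
  assumes R: "0 < R" and L: "0 < L" and r0: "0 < r0" and \<psi>0: "\<psi> 0 = p"
    and lower: "\<And>v w. v \<in> ball 0 R \<Longrightarrow> w \<in> ball 0 R \<Longrightarrow> dist v w \<le> L * dist (\<psi> v) (\<psi> w)"
    and upper: "\<And>v w. v \<in> ball 0 R \<Longrightarrow> w \<in> ball 0 R \<Longrightarrow> dist (\<psi> v) (\<psi> w) \<le> L * dist v w"
    and onto: "ball p r0 \<subseteq> \<psi> ` ball 0 R"
    and s: "s = real n - \<alpha>" "0 < s" "s < real DIM('e) - 1"
  shows "\<exists>c>0. \<exists>r1>0. \<forall>r. 0 < r \<and> r < r1 \<longrightarrow>
    ennreal (c * r powr s) \<le> capacity n \<alpha> (frontier (ball p r)) (ball p (2 * r))"
proof -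
  let ?m = "real DIM('e) - 1"
  define K where "K = 3 * 2 ^ DIM('e) * unit_ball_vol (real DIM('e))"
  \<comment> \<open>Chosen such that the potential of the test measure is at most \<open>B r\<^sup>-\<^sup>s\<close>.\<close>
  define B where "B = K * (L * L) powr ?m * 2 powr ?m * 2 powr (?m - s) / (1 - (1 / 2) powr (?m - s))"
  \<comment> \<open>Below \<open>r1\<close> the ball of radius \<open>2r\<close> is covered by the chart, and the coordinate image of the
    ball of radius \<open>r\<close> has its closure inside the domain \<open>ball 0 R\<close>.\<close>
  define r1 where "r1 = min (r0 / 2) (min (R / L) (R * L))"
  have K: "0 < K" unfolding K_def by simp
  have half: "(1 / 2 :: real) powr (?m - s) < 1"
    using s(3) powr_less_mono2[of "?m - s" "1 / 2" 1] by simp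
  have B: "0 < B" unfolding B_def using K L half by simp
  have r1: "0 < r1" using R L r0 unfolding r1_def by simp
  have cont: "continuous_on (ball 0 R) \<psi>"
  proof (rule lipschitz_on_continuous_on)
    show "L-lipschitz_on (ball 0 R) \<psi>" using upper L by (intro lipschitz_onI) auto
  qed
  \<comment> \<open>The origin is removed because it determines no ray.\<close>
  define N where "N = restrict_space (lborel :: 'e measure) (ball 0 1 - {0})"
  have spN: "space N = ball 0 1 - {0}" unfolding N_def by (simp add: space_restrict_space)
  have emN: "emeasure N X = emeasure lborel X" if "X \<in> sets N" for X
    unfolding N_def using that sets.sets_into_space[OF that] spN
    by (subst emeasure_restrict_space) auto
  have setsN: "X \<in> sets lborel" if "X \<in> sets N" for X
    using that unfolding N_def by (auto simp: sets_restrict_space)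
  have massN: "emeasure N (space N) = ennreal (unit_ball_vol (real DIM('e)))"
  proof -
    have "emeasure N (space N) = emeasure lborel (ball 0 1 - {0} :: 'e set)"
      using emN[OF sets.top] spN by simp
    also have "\<dots> = emeasure lborel (ball (0::'e) 1)"
      by (subst emeasure_Diff) auto
    finally show ?thesis by (simp add: emeasure_ball)
  qed
  have finN: "finite_measure N" by (rule finite_measureI) (simp add: massN)
  have main: "ennreal (unit_ball_vol (real DIM('e)) / B * r powr s)
      \<le> capacity n \<alpha> (frontier (ball p r)) (ball p (2 * r))" if r: "0 < r" "r < r1" for r
  proof -
    have r': "2 * r < r0" "L * r < R" "r / L < R"
      using r L unfolding r1_def by (auto simp: field_simps)
    define W where "W = ball 0 R \<inter> \<psi> -` ball p r"
    have "open W" unfolding W_def by (rule continuous_open_preimage[OF cont]) auto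
    have Wsub: "W \<subseteq> cball 0 (L * r)"
    proof
      fix v assume "v \<in> W"
      then have v: "v \<in> ball 0 R" "dist (\<psi> 0) (\<psi> v) < r" unfolding W_def \<psi>0 by auto
      have "dist 0 v \<le> L * dist (\<psi> 0) (\<psi> v)" using lower[of 0 v] v R by simp
      also have "\<dots> \<le> L * r" using v L by simp
      finally show "v \<in> cball 0 (L * r)" by simp
    qed
    have "bounded W" by (rule bounded_subset[OF bounded_cball Wsub])
    have ballW: "ball 0 (r / L) \<subseteq> W"
    proof
      fix v :: 'e assume v: "v \<in> ball 0 (r / L)"
      then have vR: "v \<in> ball 0 R" using r' by auto
      have "dist p (\<psi> v) \<le> L * dist 0 v" using upper[of 0 v] vR R \<psi>0 by simp
      also have "\<dots> < r" using v L by (simp add: field_simps)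
      finally show "v \<in> W" unfolding W_def using vR by simp
    qed
    have clW: "closure W \<subseteq> cball 0 (L * r)" by (rule closure_minimal[OF Wsub closed_cball])
    have clWR: "closure W \<subseteq> ball 0 R" using clW r' by (auto simp: subset_iff)
    obtain T where T[measurable]: "T \<in> borel_measurable borel"
      and T': "\<And>u. u \<noteq> 0 \<Longrightarrow> T u *\<^sub>R u \<in> closure W - W"
        "\<And>u. u \<noteq> 0 \<Longrightarrow> 0 < T u" "\<And>u. u \<noteq> 0 \<Longrightarrow> r / L \<le> T u * norm u"
      using first_exit_time[OF \<open>open W\<close> \<open>bounded W\<close> _ ballW] r L by auto
    define F where "F u = \<psi> (T u *\<^sub>R u)" for u
    have TR: "T u *\<^sub>R u \<in> ball 0 R" if "u \<noteq> 0" for u using T'(1)[OF that] clWR by blast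
    have Fm[measurable]: "F \<in> borel_measurable N"
    proof -
      have "(\<lambda>u. T u *\<^sub>R u) \<in> borel_measurable N"
        unfolding N_def by (rule measurable_restrict_space1) simp
      then have "(\<lambda>u. T u *\<^sub>R u) \<in> measurable N (restrict_space borel (ball 0 R))"
        by (intro measurable_restrict_space2) (use TR spN in auto)
      moreover have "\<psi> \<in> measurable (restrict_space borel (ball 0 R)) borel"
        by (rule borel_measurable_continuous_on_restrict[OF cont])
      ultimately show ?thesis unfolding F_def by (rule measurable_compose)
    qed
    have Ffr: "F u \<in> frontier (ball p r)" if "u \<in> space N" for u
    proof -
      have u: "u \<noteq> 0" using that spN by blast
      have "\<psi> ` closure W \<subseteq> closure (ball p r)"
      proof (rule image_closure_subset)
        show "continuous_on (closure W) \<psi>" by (rule continuous_on_subset[OF cont clWR])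
        show "\<psi> ` W \<subseteq> closure (ball p r)" unfolding W_def using closure_subset by fastforce
      qed simp
      then have "F u \<in> closure (ball p r)" unfolding F_def using T'(1)[OF u] by blast
      moreover have "F u \<notin> ball p r" using T'(1)[OF u] TR[OF u] unfolding F_def W_def by blast
      ultimately show ?thesis unfolding frontier_def by (simp add: interior_open)
    qed
    \<comment> \<open>All distances are below \<open>3r\<close>, so \<open>2r\<close> serves as the largest dyadic scale.\<close>
    have pot: "(\<integral>\<^sup>+u. riesz_kernel (real n - \<alpha>) (F u) y \<partial>N) \<le> ennreal (B * r powr (- s))"
      if y: "y \<in> ball p (2 * r)" for y
    proof -
      obtain z where z: "z \<in> ball 0 R" "y = \<psi> z" using y r' onto by force
      define C where "C = K * (L * L / r) powr ?m"
      have C: "0 < C" unfolding C_def using K L r by simp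
      have dm: "(\<lambda>u. dist (F u) y) \<in> borel_measurable N" by measurable
      have dens: "emeasure N {u\<in>space N. dist (F u) y < t} \<le> ennreal (C * t powr ?m)"
        if t: "0 < t" for t
      proof -
        let ?X = "{u\<in>space N. dist (F u) y < t}"
        let ?\<eta> = "L * L / r * t"
        have X: "?X \<in> sets N" using dm by measurable
        have "emeasure N ?X = emeasure lborel ?X" by (rule emN[OF X])
        also have "\<dots> \<le> ennreal (3 * 2 ^ DIM('e) * unit_ball_vol (real DIM('e)) * ?\<eta> powr ?m)"
        proof (rule emeasure_tube_le[OF setsN[OF X]])
          show "?X \<subseteq> ball 0 1" using spN by blast
          show "0 < ?\<eta>" using L r t by simp
          fix u assume u: "u \<in> ?X"
          then have u0: "u \<noteq> 0" "norm u < 1" using spN by auto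
          have "T u * norm u \<le> T u" using T'(2)[OF u0(1)] u0(2) by (intro mult_left_le) auto
          then have Tu: "0 < T u" "r / L \<le> T u"
            using T'(2,3)[OF u0(1)] by (blast, blast intro: order_trans)
          have "dist (T u *\<^sub>R u) z \<le> L * dist (F u) y"
            unfolding F_def z(2) by (rule lower[OF TR[OF u0(1)] z(1)])
          also have "\<dots> < L * t" using u L by simp
          finally have d: "norm (T u *\<^sub>R u - z) < L * t" by (simp add: dist_norm)
          have "u - (1 / T u) *\<^sub>R z = (1 / T u) *\<^sub>R (T u *\<^sub>R u - z)"
            using Tu(1) by (simp add: scaleR_diff_right)
          then have "norm (u - (1 / T u) *\<^sub>R z) = norm (T u *\<^sub>R u - z) / T u"
            using Tu(1) by simp
          also have "\<dots> < L * t / T u" using d Tu(1) by (rule divide_strict_right_mono)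
          also have "\<dots> \<le> L * t / (r / L)"
            using Tu L t r by (intro divide_left_mono) auto
          also have "\<dots> = ?\<eta>" by simp
          finally have "norm (u - (1 / T u) *\<^sub>R z) < ?\<eta>" .
          then show "\<exists>l\<ge>0. norm (u - l *\<^sub>R z) < ?\<eta>"
            using Tu(1) by (intro exI[of _ "1 / T u"]) simp
        qed
        also have "3 * 2 ^ DIM('e) * unit_ball_vol (real DIM('e)) * ?\<eta> powr ?m = C * t powr ?m"
          unfolding C_def K_def using L r t powr_mult[of "L * L / r" t ?m] by simp
        finally show ?thesis .
      qed
      have near: "dist (F u) y < 2 * (2 * r)" if "u \<in> space N" for u
      proof -
        have "F u \<in> cball p r"
          using Ffr[OF that] closure_minimal[OF ball_subset_cball closed_cball] unfolding frontier_def by blast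
        then show ?thesis using y dist_triangle3[of "F u" y p] r(1) by simp
      qed
      have ae: "AE u in N. 0 < dist (F u) y"
        by (rule AE_pos_of_density[OF dm _ dens C]) (use s in auto)
      have "AE u in N. \<exists>k. dist (F u) y < 2 * (2 * r * (1 / 2) ^ k) \<and>
          riesz_kernel s (F u) y \<le> ennreal (1 / (2 * r * (1 / 2) ^ k) powr s)"
        using ae AE_space
      proof eventually_elim
        case (elim u)
        obtain k where k: "2 * r * (1 / 2) ^ k \<le> dist (F u) y" "dist (F u) y < 2 * (2 * r * (1 / 2) ^ k)"
          using dyadic_scale_down[OF elim(1) near[OF elim(2)]] by blast
        have "(2 * r * (1 / 2) ^ k) powr s \<le> dist (F u) y powr s"
          using k(1) s(2) r(1) by (intro powr_mono2) auto
        then have "riesz_kernel s (F u) y \<le> ennreal (1 / (2 * r * (1 / 2) ^ k) powr s)"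
          using elim(1) r(1) unfolding riesz_kernel_def
          by (auto intro!: ennreal_leI divide_left_mono)
        then show ?case using k(2) by blast
      qed
      then have "(\<integral>\<^sup>+u. riesz_kernel s (F u) y \<partial>N)
          \<le> ennreal (C * 2 powr ?m * (2 * r) powr (?m - s) / (1 - (1 / 2) powr (?m - s)))"
        using C r half by (intro nn_integral_le_dyadic[OF dm dens]) auto
      also have "C * 2 powr ?m * (2 * r) powr (?m - s) / (1 - (1 / 2) powr (?m - s)) = B * r powr (- s)"
      proof -
        have "(L * L / r) powr ?m * (2 * r) powr (?m - s)
            = (L * L) powr ?m * 2 powr (?m - s) * r powr (- s)"
          using L r(1) by (simp add: powr_divide powr_mult powr_diff powr_minus powr_mult_base field_simps)
        then show ?thesis unfolding B_def C_def by (simp add: field_simps)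
      qed
      finally show ?thesis unfolding s(1) .
    qed
    have "emeasure N (space N) / ennreal (B * r powr (- s)) \<le> capacity n \<alpha> (frontier (ball p r)) (ball p (2 * r))"
      using B r(1) by (intro capacity_ge_of_test_measure[OF finN Fm Ffr _ pot]) auto
    moreover have "emeasure N (space N) / ennreal (B * r powr (- s)) =
        ennreal (unit_ball_vol (real DIM('e)) / B * r powr s)"
      unfolding massN using B r(1) by (subst divide_ennreal) (auto simp: powr_minus field_simps)
    ultimately show ?thesis by simp
  qed
  show ?thesis
    using B r1 main by (intro exI[of _ "unit_ball_vol (real DIM('e)) / B"] conjI exI[of _ r1]) auto
qed


section \<open>Growth of the potential off a thin set\<close>

text \<open>
The part of the argument that uses only the metric: density of \<open>\<mu>\<close> at \<open>p\<close> and a lower bound for the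
capacity of small spheres about \<open>p\<close>.
\<close>

lemma growth_off_thin_set:
  fixes \<mu> :: "'a::{metric_space, second_countable_topology} measure"
  assumes G: "open G" "p \<in> G" and \<mu>: "radon_measure_on G \<mu>"
    and s: "s = real n - \<alpha>" "0 < s" and m: "d < m" "m < s"
    and C: "0 < C"
    and dens: "\<And>t. 0 < t \<Longrightarrow> emeasure (distr \<mu> borel (\<lambda>y. y)) (ball p t) \<le> ennreal (C * t powr m)"
    and cap: "0 < c" "0 < r1"
      "\<And>r. 0 < r \<Longrightarrow> r < r1 \<Longrightarrow> ennreal (c * r powr s) \<le> capacity n \<alpha> (frontier (ball p r)) (ball p (2 * r))"
  shows "\<exists>(E::'a set) (C::real) \<delta>. thin_at n \<alpha> E p \<and> C > 0 \<and> \<delta> > 0 \<and>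
    (\<forall>x \<in> ball p \<delta> - E.
      (\<integral>\<^sup>+ y. riesz_kernel s x y \<partial>\<mu>) \<le> ennreal C * riesz_kernel (s - d) x p)"
proof -
  note sp = radon_measure_onD(2)[OF \<mu>] and id = radon_measure_onD(3)[OF \<mu>]
  let ?M = "distr \<mu> borel (\<lambda>y. y)"
  obtain \<rho>0 where \<rho>0: "0 < \<rho>0" "ball p \<rho>0 \<subseteq> G" using G open_contains_ball by blast
  \<comment> \<open>The largest \<open>\<Omega> (Suc i)\<close> lies in the ball of radius \<open>2\<delta>\<close>, hence in \<open>G\<close>, where \<open>\<mu>\<close> lives; and
    \<open>\<delta> \<le> 1\<close> allows to compare powers of \<open>r i\<close>.\<close>
  define \<delta> where "\<delta> = min 1 (min r1 (\<rho>0 / 2))"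
  have \<delta>: "0 < \<delta>" "\<delta> \<le> 1" "\<delta> \<le> r1" "2 * \<delta> \<le> \<rho>0" using cap \<rho>0 unfolding \<delta>_def by auto
  define r where "r i = \<delta> / 2 ^ i" for i :: nat
  have r: "0 < r i" "r i \<le> 1" for i using \<delta> unfolding r_def by (auto simp: divide_le_eq order_trans[OF _ one_le_power])
  have rS: "r (Suc i) < r1" "4 * r (Suc i) \<le> \<rho>0" for i
  proof -
    have "r (Suc i) \<le> \<delta> / 2" using \<delta>(1) unfolding r_def by (intro divide_left_mono) auto
    then show "r (Suc i) < r1" "4 * r (Suc i) \<le> \<rho>0" using \<delta> by linarith+
  qed
  define \<Omega> where "\<Omega> i = open_annulus \<delta> p i" for i
  have \<Omega>: "\<Omega> i = {y. dist y p \<in> {r i / 2 <..< 4 * r i}}" for i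
    unfolding \<Omega>_def open_annulus_def r_def by (simp add: field_simps)
  have \<Omega>o: "open (\<Omega> i)" for i
  proof -
    have "\<Omega> i = ball p (4 * r i) - cball p (r i / 2)" unfolding \<Omega> by (auto simp: dist_commute)
    then show ?thesis by (simp add: open_Diff)
  qed
  have \<Omega>ball: "\<Omega> i \<subseteq> ball p (4 * r i)" for i unfolding \<Omega> by (auto simp: dist_commute)
  have \<Omega>G: "\<Omega> (Suc i) \<subseteq> G" for i using \<Omega>ball[of "Suc i"] rS(2)[of i] \<rho>0(2) by (auto simp: subset_iff)
  define near where "near i x = (\<integral>\<^sup>+y. riesz_kernel s x y * indicator (\<Omega> i) y \<partial>\<mu>)" for i x
  \<comment> \<open>Neighbouring closed annuli share a sphere. A point of \<open>E\<close> must have a large near potential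
    with respect to every annulus that contains it, so that each intersection of \<open>E\<close> with an
    annulus is covered by the corresponding capacity estimate.\<close>
  define E where "E = {x \<in> ball p \<delta>. x \<noteq> p \<and>
    (\<forall>i. x \<in> closed_annulus \<delta> p (Suc i) \<longrightarrow> ennreal (r (Suc i) powr (d - s)) \<le> near (Suc i) x)}"

  define Q where "Q = C * 4 powr m / c"
  have Q: "0 \<le> Q" unfolding Q_def using C cap by simp
  have thin_term_le: "thin_term n \<alpha> E p \<delta> (Suc i) \<le> ennreal (Q * r (Suc i) powr (m - d))" for i
  proof -
    let ?r = "r (Suc i)"
    have "capacity n \<alpha> (E \<inter> closed_annulus \<delta> p (Suc i)) (\<Omega> (Suc i))
        \<le> ennreal (1 / ?r powr (d - s)) * emeasure \<mu> (\<Omega> (Suc i))"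
    proof (rule capacity_le_of_near_potential[OF \<mu> \<Omega>o \<Omega>G])
      show "0 < ?r powr (d - s)" using r(1)[of "Suc i"] by simp
      show "ennreal (?r powr (d - s))
          \<le> (\<integral>\<^sup>+y. riesz_kernel (real n - \<alpha>) x y * indicator (\<Omega> (Suc i)) y \<partial>\<mu>)"
        if "x \<in> E \<inter> closed_annulus \<delta> p (Suc i)" for x
        using that unfolding E_def near_def s(1) by blast
    qed
    also have "emeasure \<mu> (\<Omega> (Suc i)) = emeasure ?M (\<Omega> (Suc i))"
      using \<Omega>o[of "Suc i"] \<Omega>G[of i] sp id by (subst emeasure_distr) (auto simp: Int_absorb2)
    also have "\<dots> \<le> emeasure ?M (ball p (4 * ?r))" using \<Omega>ball by (intro emeasure_mono) auto
    also have "\<dots> \<le> ennreal (C * (4 * ?r) powr m)" using r(1)[of "Suc i"] by (intro dens) simp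
    also have "ennreal (1 / ?r powr (d - s)) * ennreal (C * (4 * ?r) powr m)
        = ennreal (1 / ?r powr (d - s) * (C * (4 * ?r) powr m))"
      by (rule ennreal_mult[symmetric]) (use C in auto)
    finally have num: "capacity n \<alpha> (E \<inter> closed_annulus \<delta> p (Suc i)) (\<Omega> (Suc i))
        \<le> ennreal (1 / ?r powr (d - s) * (C * (4 * ?r) powr m))"
      by (simp add: mult_left_mono)
    let ?D = "capacity n \<alpha> (frontier (ball p (\<delta> / 2 ^ Suc i))) (ball p (2 * \<delta> / 2 ^ Suc i))"
    have den: "ennreal (c * ?r powr s) \<le> ?D"
      using cap(3)[OF r(1) rS(1), of i] unfolding r_def by simp
    have "1 / ?r powr (d - s) * (C * (4 * ?r) powr m) = c * ?r powr s * (Q * ?r powr (m - d))"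
      using r(1)[of "Suc i"] cap(1) unfolding Q_def by (simp add: powr_mult powr_diff field_simps)
    then have "ennreal (1 / ?r powr (d - s) * (C * (4 * ?r) powr m))
        = ennreal (c * ?r powr s) * ennreal (Q * ?r powr (m - d))"
      using cap(1) Q by (simp add: ennreal_mult)
    also have "\<dots> \<le> ?D * ennreal (Q * ?r powr (m - d))" using den by (rule mult_right_mono) simp
    finally have "capacity n \<alpha> (E \<inter> closed_annulus \<delta> p (Suc i)) (\<Omega> (Suc i))
        \<le> ?D * ennreal (Q * ?r powr (m - d))" using num by (rule order_trans[rotated])
    moreover have "0 < ennreal (c * ?r powr s)" using cap(1) r(1)[of "Suc i"] by simp
    then have "0 < ?D" using den by (rule order.strict_trans2)
    ultimately show ?thesis
      unfolding thin_term_def \<Omega>_def by (intro divide_le_posI_ennreal)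
  qed
  have thin: "thin_at n \<alpha> E p"
    unfolding thin_at_def
  proof (intro exI[of _ \<delta>] conjI \<delta>(1))
    let ?q = "(1 / 2 :: real) powr (m - d)"
    have q: "?q < 1" using m powr_less_mono2[of "m - d" "1 / 2" 1] by simp
    have pw: "r i powr (m - d) = \<delta> powr (m - d) * ?q ^ i" for i
    proof -
      have "(2 ^ i :: real) powr (m - d) = (2 powr (m - d)) ^ i" by (induction i) (simp_all add: powr_mult)
      then show ?thesis using \<delta>(1) unfolding r_def by (simp add: powr_divide power_divide)
    qed
    have "(\<Sum>i. thin_term n \<alpha> E p \<delta> (Suc i)) \<le> (\<Sum>i. ennreal (Q * \<delta> powr (m - d) * ?q * ?q ^ i))"
      using thin_term_le unfolding pw by (intro suminf_le) (auto simp: mult_ac)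
    also have "\<dots> = ennreal (Q * \<delta> powr (m - d) * ?q * (1 / (1 - ?q)))"
      using Q q by (intro suminf_ennreal_eq sums_mult geometric_sums) auto
    finally show "(\<Sum>i. thin_term n \<alpha> E p \<delta> (Suc i)) < \<infinity>"
      by (rule order.strict_trans1) simp
  qed
  define K where "K = C * 2 powr m * 2 powr m * 4 powr (s - m) / (1 - 2 powr (m - s))"
  have K: "0 \<le> K" using C m powr_less_mono[of "m - s" 0 2] unfolding K_def by simp
  define C' where "C' = (1 + K) * 2 powr (s - d)"
  have C': "0 < C'" using K unfolding C'_def by simp
  have growth: "(\<integral>\<^sup>+ y. riesz_kernel s x y \<partial>\<mu>) \<le> ennreal C' * riesz_kernel (s - d) x p"
    if x: "x \<in> ball p \<delta> - E" for x
  proof (cases "x = p")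
    case True
    \<comment> \<open>The right-hand side is infinite at \<open>p\<close>.\<close>
    then show ?thesis using C' by (simp add: riesz_kernel_def ennreal_mult_top)
  next
    case False
    then obtain i where i: "x \<in> closed_annulus \<delta> p (Suc i)"
      "near (Suc i) x \<le> ennreal (r (Suc i) powr (d - s))"
      using x unfolding E_def by (auto simp: not_le)
    let ?r = "r (Suc i)"
    have dx: "?r \<le> dist x p" "dist x p \<le> 2 * ?r"
      using i(1) unfolding closed_annulus_def r_def by auto
    have rk: "(\<lambda>y. riesz_kernel s x y) \<in> borel_measurable borel"
      by (rule riesz_kernel_measurable) auto
    have rk\<mu>: "(\<lambda>y. riesz_kernel s x y) \<in> borel_measurable \<mu>"
      by (rule riesz_kernel_measurable[OF _ id]) simp
    have \<Omega>b: "\<Omega> (Suc i) \<in> sets borel" by (rule borel_open[OF \<Omega>o])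
    have ind: "(\<lambda>y. indicator X y :: ennreal) \<in> borel_measurable \<mu>" if "X \<in> sets borel" for X
      using measurable_compose[OF id borel_measurable_indicator[OF that]] .
    have "(\<integral>\<^sup>+ y. riesz_kernel s x y * indicator (- \<Omega> (Suc i)) y \<partial>\<mu>)
        = (\<integral>\<^sup>+ y. riesz_kernel s x y * indicator (- \<Omega> (Suc i)) y \<partial>?M)"
      using \<Omega>b
      by (intro nn_integral_distr[symmetric, OF id] borel_measurable_times_ennreal rk
          borel_measurable_indicator) auto
    also have "\<dots> \<le> ennreal (K * ?r powr (m - s))"
      unfolding K_def \<Omega> using C by (intro far_potential_le[OF _ dens _ m(2) s(2) r(1) dx]) auto
    also have "\<dots> \<le> ennreal (K * ?r powr (d - s))"
      using K r[of "Suc i"] m by (intro ennreal_leI mult_left_mono powr_mono') auto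
    finally have far: "(\<integral>\<^sup>+ y. riesz_kernel s x y * indicator (- \<Omega> (Suc i)) y \<partial>\<mu>)
        \<le> ennreal (K * ?r powr (d - s))" .
    have "(\<integral>\<^sup>+ y. riesz_kernel s x y \<partial>\<mu>) =
        (\<integral>\<^sup>+ y. riesz_kernel s x y * indicator (\<Omega> (Suc i)) y + riesz_kernel s x y * indicator (- \<Omega> (Suc i)) y \<partial>\<mu>)"
      by (intro nn_integral_cong) (auto simp: indicator_def)
    also have "\<dots> = near (Suc i) x + (\<integral>\<^sup>+ y. riesz_kernel s x y * indicator (- \<Omega> (Suc i)) y \<partial>\<mu>)"
      unfolding near_def using \<Omega>b
      by (intro nn_integral_add borel_measurable_times_ennreal rk\<mu> ind) auto
    also have "\<dots> \<le> ennreal (?r powr (d - s)) + ennreal (K * ?r powr (d - s))"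
      by (rule add_mono[OF i(2) far])
    also have "\<dots> = ennreal ((1 + K) * ?r powr (d - s))"
      using K by (simp add: distrib_right flip: ennreal_plus)
    also have "\<dots> \<le> ennreal (C' * (1 / dist x p powr (s - d)))"
    proof (rule ennreal_leI)
      have d: "0 < dist x p" using False by simp
      have "dist x p powr (s - d) \<le> (2 * ?r) powr (s - d)"
        using dx d m by (intro powr_mono2) auto
      also have "\<dots> = 2 powr (s - d) * ?r powr (s - d)" using r[of "Suc i"] by (simp add: powr_mult)
      finally have "1 / ?r powr (s - d) \<le> 2 powr (s - d) * (1 / dist x p powr (s - d))"
        using d r(1)[of "Suc i"] by (simp add: field_simps)
      moreover have "?r powr (d - s) = 1 / ?r powr (s - d)"
        using powr_minus_divide[of ?r "s - d"] by simp
      ultimately have "(1 + K) * ?r powr (d - s) \<le> (1 + K) * (2 powr (s - d) * (1 / dist x p powr (s - d)))"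
        using K by (intro mult_left_mono) auto
      then show "(1 + K) * ?r powr (d - s) \<le> C' * (1 / dist x p powr (s - d))"
        unfolding C'_def by (simp add: mult.assoc)
    qed
    also have "\<dots> = ennreal C' * riesz_kernel (s - d) x p"
      using False C' unfolding riesz_kernel_def by (simp add: ennreal_mult[symmetric])
    finally show ?thesis .
  qed
  show ?thesis using thin growth C' \<delta>(1) by blast
qed

theorem theorem1p1:
  fixes A :: "('a::{metric_space, second_countable_topology}, 'n::finite) chart set"
    and g :: "('a, 'n) metric_tensor"
    and G S :: "'a set"
    and \<mu> :: "'a measure"
    and \<alpha> d :: real
  assumes "complete_riemannian_manifold A g"
    and "open G" and "connected G" and "bounded G"
    and "radon_measure_on G \<mu>" and "finite_measure \<mu>"
    and "1 < \<alpha>" and "\<alpha> < real CARD('n)"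
    and "d < real CARD('n) - \<alpha>"
    and "compact S" and "S \<subseteq> G"
    and "hausdorff_dim S > ereal d"
  shows "\<exists>p\<in>S. \<exists>(E::'a set) (C::real) \<delta>. thin_at CARD('n) \<alpha> E p \<and> C > 0 \<and> \<delta> > 0 \<and>
           (\<forall>x \<in> ball p \<delta> - E.
              (\<integral>\<^sup>+ y. riesz_kernel (real CARD('n) - \<alpha>) x y \<partial>\<mu>)
                \<le> ennreal C * riesz_kernel (real CARD('n) - \<alpha> - d) x p)"
proof -
  let ?n = "CARD('n)" and ?s = "real CARD('n) - \<alpha>"
  have mf: "riemannian_manifold A g" and dist: "\<And>x y. dist x y = riemannian_dist A g x y"
    using assms(1) unfolding complete_riemannian_manifold_def by blast+
  have ne: "S \<noteq> {}" using assms(12) unfolding hausdorff_dim_def by auto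
  have "\<exists>m. 0 \<le> m \<and> d < m \<and> m < ?s \<and> hausdorff_measure m S \<noteq> 0"
  proof (cases "d < 0")
    case True
    \<comment> \<open>A negative exponent would not do, since the density bound has to hold for large radii too.\<close>
    then show ?thesis using assms(8) hausdorff_measure_zero_ne_0[OF ne] by (intro exI[of _ 0]) auto
  next
    case False
    have "ereal d < min (ereal ?s) (hausdorff_dim S)" using assms(9,12) by simp
    then obtain m where "ereal d < ereal m" "ereal m < min (ereal ?s) (hausdorff_dim S)"
      using ereal_dense2 by blast
    then show ?thesis using False hausdorff_measure_ne_0[of m S] by (intro exI[of _ m]) auto
  qed
  then obtain m where m: "0 \<le> m" "d < m" "m < ?s" "hausdorff_measure m S \<noteq> 0" by blast
  \<comment> \<open>The image under the inclusion extends \<open>\<mu>\<close> by zero to the Borel sets of the manifold.\<close>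
  let ?M = "distr \<mu> borel (\<lambda>y. y)"
  have "finite_measure ?M"
    by (rule finite_measure.finite_measure_distr[OF assms(6) radon_measure_onD(3)[OF assms(5)]])
  then obtain p C where p: "p \<in> S" "0 < C" "\<And>t. 0 < t \<Longrightarrow> emeasure ?M (ball p t) \<le> ennreal (C * t powr m)"
    using exists_point_of_bounded_density[of ?M, OF _ _ assms(10) m(1,4)] by auto
  have spos: "0 < ?s" using assms(8) by simp
  have "p \<in> G" using p(1) assms(11) by blast
  show ?thesis
  proof (rule bilipschitz_chart[OF mf dist, of p])
    fix \<psi> :: "real ^ 'n \<Rightarrow> 'a" and R L r0
    assume chart: "0 < R" "0 < L" "0 < r0" "\<psi> 0 = p"
      "\<And>v w. v \<in> ball 0 R \<Longrightarrow> w \<in> ball 0 R \<Longrightarrow> dist v w \<le> L * dist (\<psi> v) (\<psi> w)"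
      "\<And>v w. v \<in> ball 0 R \<Longrightarrow> w \<in> ball 0 R \<Longrightarrow> dist (\<psi> v) (\<psi> w) \<le> L * dist v w"
      "ball p r0 \<subseteq> \<psi> ` ball 0 R"
    have dim: "?s < real DIM(real ^ 'n) - 1" using assms(7) by simp
    obtain c r1 where cap: "0 < c" "0 < r1"
      "\<And>r. 0 < r \<Longrightarrow> r < r1 \<Longrightarrow> ennreal (c * r powr ?s) \<le> capacity ?n \<alpha> (frontier (ball p r)) (ball p (2 * r))"
      using capacity_frontier_ball_ge[OF chart refl spos dim] by blast
    show ?thesis
      by (rule bexI[where x = p, OF _ p(1)])
        (rule growth_off_thin_set[OF assms(2) \<open>p \<in> G\<close> assms(5) refl spos m(2,3) p(2,3) cap])
  qed
qed

end
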